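(* Let $q$ be a prime power and $n$ a positive integer. Let $L_0,L_1$ be $q^2$-linear polynomials over $\mathbb F_{q^{2n}}$ of degree less than $q^{2n}$, let $C_0$ and $C_1$ be coefficient matrices of $\sigma_{L_0}$ and $\sigma_{L_1}$ respectively (with respect to some bases), and suppose both $C_0$ and $C_1$ are nonsingular. Then the following are equivalent: (1) $\sigma_{L_0}$ and $\sigma_{L_1}$ are equivalent; (2) $C_0^*C_0^{-1}$ and $C_1^*C_1^{-1}$ are conjugate in $\mathrm{GL}_n(q^2)$; (3) $PM_{L_0}^*M_{L_0}^{-1}$ and $PM_{L_1}^*M_{L_1}^{-1}$ are conjugate in $\mathrm{GL}_n(q^{2n})$.
   Context: $\mathrm{Tr}$ is the trace $\mathbb F_{q^{2n}}\to\mathbb F_{q^2}$, and for a $q^2$-linear polynomial $L$, $\sigma_L(u,v)=\mathrm{Tr}(uL(v^q))$, a sesquilinear form of $\mathbb F_{q^{2n}}/\mathbb F_{q^2}$ (linear in the first argument, semilinear w.r.t. $x\mapsto x^q$ in the second). Two sesquilinear forms $\sigma,\sigma'$ are equivalent if there is an $\mathbb F_{q^2}$-linear automorphism $\tau$ of $\mathbb F_{q^{2n}}$ with $\sigma(u,v)=\sigma'(\tau(u),\tau(v))$ for all $u,v$. The coefficient matrix of $\sigma$ w.r.t. a basis $\beta_1,\dots,\beta_n$ of $\mathbb F_{q^{2n}}/\mathbb F_{q^2}$ has $(i,j)$ entry $\sigma(\beta_i,\beta_j)$. For a matrix $M$, $M^*$ is the transpose of $M$ with every entry raised to the $q$-th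 power. For $L(x)=\sum_{i=0}^{n-1}a_ix^{q^{2i}}$, $M_L$ is the $n\times n$ matrix whose $(i,j)$ entry ($1\le i,j\le n$) is $a_{(j-i)\bmod n}^{q^{2(i-1)}}$, i.e. row $i$ is the $(i-1)$-fold cyclic right shift of $(a_0,\dots,a_{n-1})$ with entries raised to the $q^{2(i-1)}$ power. $P$ is the $n\times n$ permutation matrix with entries $1$ in positions $(1,n)$ and $(i+1,i)$ for $1\le i\le n-1$, and $0$ elsewhere. $\mathrm{GL}_n(Q)$ denotes the group of nonsingular $n\times n$ matrices over $\mathbb F_Q$. *)

theory Defs
  imports "Jordan_Normal_Form.Determinant" "HOL-Computational_Algebra.Primes"
begin

text \<open>Ambient field: a finite field type 'a with CARD('a) = q^(2n).
  Everything is parametrised explicitly by q and n.\<close>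

definition prime_power :: "nat \<Rightarrow> bool" where
  "prime_power q \<longleftrightarrow> (\<exists>p k. prime p \<and> k > 0 \<and> q = p ^ k)"

definition subF :: "nat \<Rightarrow> 'a::field set" where
  "subF q = {x. x ^ (q^2) = x}"

definition Tr :: "nat \<Rightarrow> nat \<Rightarrow> 'a::field \<Rightarrow> 'a" where
  "Tr q n x = (\<Sum>i<n. x ^ (q ^ (2*i)))"

text \<open>q^2-linear polynomial L(x) = sum_(i<n) a_i x^(q^(2i)) (degree < q^(2n)),
  given by its coefficient sequence a (only a 0..a (n-1) matter).\<close>
definition linpoly :: "nat \<Rightarrow> nat \<Rightarrow> (nat \<Rightarrow> 'a::field) \<Rightarrow> 'a \<Rightarrow> 'a" where
  "linpoly q n a x = (\<Sum>i<n. a i * x ^ (q ^ (2*i)))"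

definition sform :: "nat \<Rightarrow> nat \<Rightarrow> (nat \<Rightarrow> 'a::field) \<Rightarrow> 'a \<Rightarrow> 'a \<Rightarrow> 'a" where
  "sform q n a u v = Tr q n (u * linpoly q n a (v ^ q))"

definition lin_aut :: "nat \<Rightarrow> ('a::field \<Rightarrow> 'a) \<Rightarrow> bool" where
  "lin_aut q \<tau> \<longleftrightarrow> bij \<tau> \<and> (\<forall>x y. \<tau> (x + y) = \<tau> x + \<tau> y)
      \<and> (\<forall>c\<in>subF q. \<forall>x. \<tau> (c * x) = c * \<tau> x)"

definition forms_equiv :: "nat \<Rightarrow> ('a::field \<Rightarrow> 'a \<Rightarrow> 'a) \<Rightarrow> ('a \<Rightarrow> 'a \<Rightarrow> 'a) \<Rightarrow> bool" where
  "forms_equiv q \<sigma> \<sigma>' \<longleftrightarrow> (\<exists>\<tau>. lin_aut q \<tau> \<and> (\<forall>u v. \<sigma> u v = \<sigma>' (\<tau> u) (\<tau> v)))"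

definition is_basis :: "nat \<Rightarrow> nat \<Rightarrow> (nat \<Rightarrow> 'a::field) \<Rightarrow> bool" where
  "is_basis q n \<beta> \<longleftrightarrow> (\<forall>x. \<exists>!c. (\<forall>i<n. c i \<in> subF q) \<and> (\<forall>i. n \<le> i \<longrightarrow> c i = 0)
       \<and> x = (\<Sum>i<n. c i * \<beta> i))"

definition coeff_mat :: "nat \<Rightarrow> ('a \<Rightarrow> 'a \<Rightarrow> 'a) \<Rightarrow> (nat \<Rightarrow> 'a) \<Rightarrow> 'a mat" where
  "coeff_mat n \<sigma> \<beta> = mat n n (\<lambda>(i,j). \<sigma> (\<beta> i) (\<beta> j))"

definition star_mat :: "nat \<Rightarrow> 'a::field mat \<Rightarrow> 'a mat" where
  "star_mat q M = mat (dim_col M) (dim_row M) (\<lambda>(i,j). (M $$ (j,i)) ^ q)"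

definition mat_inv :: "'a::field mat \<Rightarrow> 'a mat" where
  "mat_inv A = (THE B. B \<in> carrier_mat (dim_row A) (dim_row A)
        \<and> A * B = 1\<^sub>m (dim_row A) \<and> B * A = 1\<^sub>m (dim_row A))"

definition M_L :: "nat \<Rightarrow> nat \<Rightarrow> (nat \<Rightarrow> 'a::field) \<Rightarrow> 'a mat" where
  "M_L q n a = mat n n (\<lambda>(i,j). (a ((j + n - i) mod n)) ^ (q ^ (2*i)))"

definition P_mat :: "nat \<Rightarrow> 'a::field mat" where
  "P_mat n = mat n n (\<lambda>(i,j). if i = (j + 1) mod n then 1 else 0)"

definition conj_GL :: "'a::field set \<Rightarrow> nat \<Rightarrow> 'a mat \<Rightarrow> 'a mat \<Rightarrow> bool" where
  "conj_GL K n A B \<longleftrightarrow> (\<exists>S T. S \<in> carrier_mat n n \<and> T \<in> carrier_mat n n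
      \<and> S * T = 1\<^sub>m n \<and> T * S = 1\<^sub>m n
      \<and> (\<forall>i<n. \<forall>j<n. S $$ (i,j) \<in> K \<and> T $$ (i,j) \<in> K)
      \<and> B = S * A * T)"

end

theory Submission
  imports Defs "HOL-Algebra.Coset"
begin

text \<open>
  Write \<open>K\<close> for the field with \<open>q\<^sup>2\<close> elements, \<open>E\<close> for its extension of degree \<open>n\<close>, and call
  \<open>C\<^sup>* C\<^sup>-\<^sup>1\<close> the asymmetry of a form with coefficient matrix \<open>C\<close>. Equivalent forms have congruent
  coefficient matrices, \<open>C\<^sub>0 = S C\<^sub>1 S\<^sup>*\<close>, hence conjugate asymmetries. Conversely, after a change of
  basis both forms have the same asymmetry; then \<open>H = C C\<^sub>0\<^sup>-\<^sup>1\<close> is self-adjoint for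
  \<open>X\<^sup>\<dagger> = C\<^sub>0 X\<^sup>* C\<^sub>0\<^sup>-\<^sup>1\<close>, and a congruence is a solution of \<open>X X\<^sup>\<dagger> = H\<close>. It exists in the bicommutant
  of \<open>H\<close>, a finite commutative ring on which \<open>\<dagger>\<close> is an involution, because there Hilbert 90 and a
  comparison of group orders make the norm surjective onto the fixed units.

  The Moore matrix \<open>V\<close> of a basis satisfies \<open>C = V M\<^sub>L V\<^sup>*\<close> and \<open>V\<^sup>*\<^sup>* = V P\<close>, so \<open>V\<close> conjugates
  \<open>P M\<^sub>L\<^sup>* M\<^sub>L\<^sup>-\<^sup>1\<close> to the asymmetry. It remains that matrices over \<open>K\<close> that are conjugate over \<open>E\<close>
  are conjugate over \<open>K\<close>. The number of solutions \<open>X\<close> of \<open>X A = B X\<close> with image in a given subspace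
  is, over \<open>E\<close>, the \<open>n\<close>-th power of that over \<open>K\<close>; by Lovasz's cancellation argument these numbers
  determine the number of surjective solutions, which is positive for \<open>A = B\<close>.
\<close>

section \<open>Norms in finite commutative rings with involution\<close>

text \<open>The powers of \<open>z\<close> become periodic, with some period \<open>e\<close> from
  some index \<open>i\<close> on. Any positive multiple of \<open>e\<close> that is at least
  \<open>i\<close> serves as exponent.\<close>

lemma (in monoid) finite_pow_idempotent:
  assumes "finite (carrier G)" and z: "z \<in> carrier G"
  obtains k :: nat where "k > 0" and "z [^] k \<otimes> z [^] k = z [^] k"
proof -
  have "\<not> inj (\<lambda>i::nat. z [^] i)"
  proof
    assume "inj (\<lambda>i::nat. z [^] i)"
    then have "infinite (range (\<lambda>i::nat. z [^] i))" by (simp add: finite_image_iff)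
    moreover have "range (\<lambda>i::nat. z [^] i) \<subseteq> carrier G" using z by auto
    ultimately show False using assms(1) finite_subset by blast
  qed
  then obtain i j :: nat where ij: "i < j" "z [^] i = z [^] j"
    unfolding inj_def by (metis linorder_neqE_nat)
  define e where "e = j - i"
  have e: "e > 0" using ij by (simp add: e_def)
  have step: "z [^] (m + e) = z [^] m" if "m \<ge> i" for m
  proof -
    have "z [^] (m + e) = z [^] (m - i) \<otimes> z [^] j"
      using z that ij(1) by (simp add: nat_pow_mult e_def)
    also have "\<dots> = z [^] m" using z that by (simp add: ij(2)[symmetric] nat_pow_mult)
    finally show ?thesis .
  qed
  have "z [^] (m + t * e) = z [^] m" if "m \<ge> i" for m t
  proof (induction t)
    case (Suc t)
    have "z [^] (m + Suc t * e) = z [^] ((m + t * e) + e)" by (simp add: algebra_simps)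
    also have "\<dots> = z [^] m" using step[of "m + t * e"] that Suc by simp
    finally show ?case .
  qed simp
  \<comment> \<open>The factor \<open>Suc i\<close> instead of \<open>i\<close> keeps the exponent
    positive when \<open>i\<close> is zero.\<close>
  moreover have "Suc i * e \<ge> i" using e by (cases e) auto
  ultimately have "z [^] (Suc i * e + Suc i * e) = z [^] (Suc i * e)" by blast
  then show ?thesis using that[of "Suc i * e"] e z by (simp add: nat_pow_mult)
qed

text \<open>The nonempty fibres of \<open>h\<close> are translates of its kernel, so all of them
  have the size of the kernel.\<close>

lemma (in group) card_image_times_kernel:
  assumes fin: "finite (carrier G)" and h: "h \<in> hom G G"
  shows "card (h ` carrier G) * card {x \<in> carrier G. h x = \<one>} = card (carrier G)"
proof -
  have hc: "h x \<in> carrier G" if "x \<in> carrier G" for x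
    using h that by (auto simp: hom_def)
  have hm: "h (x \<otimes> y) = h x \<otimes> h y" if "x \<in> carrier G" "y \<in> carrier G" for x y
    using h that by (simp add: hom_def)
  have fib: "card {x \<in> carrier G. h x = y} = card {x \<in> carrier G. h x = \<one>}"
    if "y \<in> h ` carrier G" for y
  proof -
    from that obtain a where a: "a \<in> carrier G" "y = h a" by blast
    have "bij_betw (\<lambda>x. a \<otimes> x) {x \<in> carrier G. h x = \<one>} {x \<in> carrier G. h x = y}"
    proof (rule bij_betw_byWitness[where f' = "\<lambda>x. inv a \<otimes> x"])
      show "(\<lambda>x. inv a \<otimes> x) ` {x \<in> carrier G. h x = y} \<subseteq> {x \<in> carrier G. h x = \<one>}"
      proof
        fix v assume "v \<in> (\<lambda>x. inv a \<otimes> x) ` {x \<in> carrier G. h x = y}"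
        then obtain x where x: "x \<in> carrier G" "h x = y" "v = inv a \<otimes> x" by blast
        then have v: "v \<in> carrier G" using a(1) by simp
        have "a \<otimes> v = x" using x a(1) by (simp add: m_assoc[symmetric])
        then have "y \<otimes> h v = y" using hm[OF a(1) v] x(2) a(2) by simp
        then have "h v = \<one>" using hc a v by simp
        then show "v \<in> {x \<in> carrier G. h x = \<one>}" using v by simp
      qed
      show "(\<lambda>x. a \<otimes> x) ` {x \<in> carrier G. h x = \<one>} \<subseteq> {x \<in> carrier G. h x = y}"
        using a hc[OF a(1)] hm[OF a(1)] by auto
      show "\<forall>x\<in>{x \<in> carrier G. h x = \<one>}. inv a \<otimes> (a \<otimes> x) = x"
        using a by (auto simp only: mem_Collect_eq m_assoc[symmetric] inv_closed l_inv l_one)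
      show "\<forall>x\<in>{x \<in> carrier G. h x = y}. a \<otimes> (inv a \<otimes> x) = x"
        using a by (auto simp only: mem_Collect_eq m_assoc[symmetric] inv_closed r_inv l_one)
    qed
    then show ?thesis by (rule bij_betw_same_card[symmetric])
  qed
  have "card (carrier G) = card (\<Union>y\<in>h ` carrier G. {x \<in> carrier G. h x = y})"
    by (rule arg_cong[where f = card]) blast
  also have "\<dots> = (\<Sum>y\<in>h ` carrier G. card {x \<in> carrier G. h x = y})"
    using fin by (intro card_UN_disjoint) (simp, simp, blast)
  also have "\<dots> = (\<Sum>y\<in>h ` carrier G. card {x \<in> carrier G. h x = \<one>})"
    by (rule sum.cong[OF refl]) (rule fib)
  finally show ?thesis by (simp only: sum_constant of_nat_id)
qed

text \<open>The condition \<open>separable\<close> makes \<open>s c \<ominus> c\<close> a unit, so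
  \<open>s\<close> acts nontrivially on every nonzero quotient by an \<open>s\<close>-stable ideal.
  If \<open>s\<close> were the identity, the norm would be squaring, and units need not be
  squares.\<close>

locale finite_involution_ring = cring R for R (structure) +
  fixes s :: "'a \<Rightarrow> 'a" and c d :: 'a
  assumes fin: "finite (carrier R)"
    and s_closed [simp, intro]: "x \<in> carrier R \<Longrightarrow> s x \<in> carrier R"
    and s_add: "\<lbrakk>x \<in> carrier R; y \<in> carrier R\<rbrakk> \<Longrightarrow> s (x \<oplus> y) = s x \<oplus> s y"
    and s_mult: "\<lbrakk>x \<in> carrier R; y \<in> carrier R\<rbrakk> \<Longrightarrow> s (x \<otimes> y) = s x \<otimes> s y"
    and s_s: "x \<in> carrier R \<Longrightarrow> s (s x) = x"
    and cd [simp, intro]: "c \<in> carrier R" "d \<in> carrier R"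
    and separable: "d \<otimes> (s c \<ominus> c) = \<one>"
begin

lemma s_one: "s \<one> = \<one>"
  by (metis s_mult s_s l_one one_closed r_one s_closed)

lemma s_zero: "s \<zero> = \<zero>"
  by (metis s_add s_closed l_zero zero_closed add.l_cancel_one)

lemma s_minus: "x \<in> carrier R \<Longrightarrow> s (\<ominus> x) = \<ominus> s x"
  by (metis a_inv_closed minus_equality r_neg l_neg s_add s_closed s_zero)

lemma s_pow: "x \<in> carrier R \<Longrightarrow> s (x [^] (k::nat)) = s x [^] k"
  by (induction k) (auto simp: s_one s_mult)

lemma idempotent_pow:
  assumes "f \<in> carrier R" "f \<otimes> f = f" "k > 0" shows "f [^] (k::nat) = f"
  using assms(3)
proof (induction k)
  case (Suc k)
  then show ?case using assms by (cases k) auto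
qed simp

text \<open>Modulo \<open>a\<close> the powers of \<open>f\<close> agree with those of
  \<open>b\<close>. So the idempotent \<open>f\<close> is a multiple of \<open>a\<close>, hence
  nilpotent, hence zero.\<close>

lemma idempotent_sum_nilpotents:
  assumes f: "f \<in> carrier R" "f \<otimes> f = f" and ab: "a \<in> carrier R" "b \<in> carrier R" "f = a \<oplus> b"
    and nil: "a [^] (i::nat) = \<zero>" "b [^] (j::nat) = \<zero>" "i > 0"
  shows "f = \<zero>"
proof -
  have "\<exists>t\<in>carrier R. f [^] m = a \<otimes> t \<oplus> b [^] m" for m :: nat
  proof (induction m)
    case 0
    then show ?case using ab by (intro bexI[of _ \<zero>]) auto
  next
    case (Suc m)
    then obtain t where t: "t \<in> carrier R" "f [^] m = a \<otimes> t \<oplus> b [^] m" by blast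
    have "f [^] Suc m = (a \<otimes> t \<oplus> b [^] m) \<otimes> (a \<oplus> b)" using t ab by simp
    also have "\<dots> = a \<otimes> (t \<otimes> (a \<oplus> b) \<oplus> b [^] m) \<oplus> b [^] m \<otimes> b"
    proof -
      have "b [^] m \<in> carrier R" using ab by simp
      then show ?thesis using t(1) ab(1,2) by algebra
    qed
    finally show ?case using t ab by (intro bexI[of _ "t \<otimes> (a \<oplus> b) \<oplus> b [^] m"]) auto
  qed
  then obtain t where t: "t \<in> carrier R" "f [^] j = a \<otimes> t \<oplus> b [^] j" by blast
  show ?thesis
  proof (cases "j = 0")
    case True
    then have "\<one> = \<zero>" using nil(2) by simp
    then show ?thesis using f(1) by (metis l_one l_null)
  next
    case False
    then have "f = a \<otimes> t" using t ab nil(2) idempotent_pow[OF f, of j] by simp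
    then have "f [^] i = a [^] i \<otimes> t [^] i" using t ab by (simp add: nat_pow_distrib)
    then show ?thesis using nil t idempotent_pow[OF f, of i] by simp
  qed
qed

section \<open>Hilbert 90\<close>

text \<open>If \<open>u \<otimes> s u = \<one>\<close>, then sending \<open>x\<close> to
  \<open>u \<otimes> s x\<close> is again an involution, a twisted version of \<open>s\<close>.
  Hilbert 90 asks for a unit among its fixed points.\<close>

definition fixed :: "'a \<Rightarrow> 'a set" where
  "fixed u = {x \<in> carrier R. u \<otimes> s x = x}"

text \<open>Sums \<open>y \<oplus> u \<otimes> s y\<close> are fixed by the twisted involution.
  Those for \<open>y = \<one>\<close> and \<open>y = c\<close> generate the unit ideal because of
  \<open>separable\<close>, so after multiplication by \<open>f\<close> they cannot both be
  nilpotent.\<close>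

lemma fixed_not_nilpotent:
  assumes u: "u \<in> carrier R" "u \<otimes> s u = \<one>"
    and f: "f \<in> carrier R" "f \<otimes> f = f" "f \<noteq> \<zero>"
  obtains y where "y \<in> fixed u" "\<And>k::nat. k > 0 \<Longrightarrow> (f \<otimes> y) [^] k \<noteq> \<zero>"
proof (rule ccontr)
  assume "\<not> thesis"
  with that have *: "\<And>y. y \<in> fixed u \<Longrightarrow> \<exists>k::nat. k > 0 \<and> (f \<otimes> y) [^] k = \<zero>" by blast
  have av: "y \<oplus> u \<otimes> s y \<in> fixed u" if y: "y \<in> carrier R" for y
  proof -
    have "u \<otimes> s (y \<oplus> u \<otimes> s y) = u \<otimes> (s y \<oplus> s u \<otimes> y)"
      using u y by (simp add: s_add s_mult s_s)
    also have "\<dots> = (u \<otimes> s u) \<otimes> y \<oplus> u \<otimes> s y"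
    proof -
      have "s y \<in> carrier R" "s u \<in> carrier R" using u y by auto
      then show ?thesis using u(1) y by algebra
    qed
    also have "\<dots> = y \<oplus> u \<otimes> s y" using u y by simp
    finally show ?thesis using u y by (simp add: fixed_def)
  qed
  define y1 where "y1 = \<one> \<oplus> u \<otimes> s \<one>"
  define y2 where "y2 = c \<oplus> u \<otimes> s c"
  have y: "y1 \<in> fixed u" "y2 \<in> fixed u" using av by (auto simp: y1_def y2_def)
  have yc: "y1 \<in> carrier R" "y2 \<in> carrier R" using y by (auto simp: fixed_def)
  obtain i where i: "i > 0" "(f \<otimes> y1) [^] (i::nat) = \<zero>" using *[OF y(1)] by blast
  obtain j where j: "j > 0" "(f \<otimes> y2) [^] (j::nat) = \<zero>" using *[OF y(2)] by blast
  \<comment> \<open>The coefficients make the terms in \<open>u\<close> cancel: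
    \<open>d s(c) (1 + u) - d (c + u s(c)) = d (s(c) - c) = 1\<close>.\<close>
  define a where "a = (d \<otimes> s c) \<otimes> (f \<otimes> y1)"
  define b where "b = (\<ominus> d) \<otimes> (f \<otimes> y2)"
  have "a [^] i = (d \<otimes> s c) [^] i \<otimes> (f \<otimes> y1) [^] i"
    unfolding a_def using f yc by (intro nat_pow_distrib) auto
  then have ai: "a [^] i = \<zero>" using i by simp
  have "b [^] j = (\<ominus> d) [^] j \<otimes> (f \<otimes> y2) [^] j"
    unfolding b_def using f yc by (intro nat_pow_distrib) auto
  then have bj: "b [^] j = \<zero>" using j by simp
  have "a \<oplus> b = (d \<otimes> (s c \<ominus> c)) \<otimes> f"
  proof -
    have "s c \<in> carrier R" by simp
    then show ?thesis unfolding a_def b_def y1_def y2_def s_one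
      using u(1) f(1) cd by algebra
  qed
  then have "f = a \<oplus> b" using separable f by simp
  moreover have "a \<in> carrier R" "b \<in> carrier R" using f yc by (simp_all add: a_def b_def)
  ultimately have "f = \<zero>"
    using idempotent_sum_nilpotents[OF f(1,2) _ _ _ ai bj i(1)] by blast
  then show False using f by simp
qed

text \<open>The idempotent \<open>e\<close> marks the factor of the ring on which the \<open>u\<close>-fixed element \<open>x\<close> is
  invertible; the factor \<open>\<one> \<ominus> e\<close> can be shrunk as long as it is nonzero.\<close>
definition partial_unit :: "'a \<Rightarrow> 'a \<Rightarrow> 'a \<Rightarrow> bool" where
  "partial_unit u e x \<longleftrightarrow> e \<in> carrier R \<and> e \<otimes> e = e \<and> s e = e \<and> x \<in> fixed u \<and> e \<otimes> x = x
     \<and> (\<exists>y\<in>carrier R. x \<otimes> y = e)"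

text \<open>On the factor cut out by \<open>f = \<one> \<ominus> e\<close> there is a
  \<open>u\<close>-fixed \<open>z\<close> that is not nilpotent. An idempotent power
  \<open>g\<close> of \<open>z\<close> marks a nonzero part on which \<open>z\<close> is invertible;
  adding \<open>g\<close> to \<open>e\<close> and \<open>g \<otimes> z\<close> to \<open>x\<close>
  enlarges the marked factor.\<close>

lemma partial_unit_extend:
  assumes u: "u \<in> carrier R" "u \<otimes> s u = \<one>"
    and p: "partial_unit u e x" and ne: "e \<noteq> \<one>"
  obtains e' x' where "partial_unit u e' x'"
    "card ((\<otimes>) e ` carrier R) < card ((\<otimes>) e' ` carrier R)"
proof -
  from p obtain y where e: "e \<in> carrier R" "e \<otimes> e = e" "s e = e"
    and x: "x \<in> carrier R" "u \<otimes> s x = x" "e \<otimes> x = x" and y: "y \<in> carrier R" "x \<otimes> y = e"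
    unfolding partial_unit_def fixed_def by blast
  define f where "f = \<one> \<ominus> e"
  have f: "f \<in> carrier R" using e by (simp add: f_def)
  have ff: "f \<otimes> f = f"
  proof -
    have "f \<otimes> f = \<one> \<ominus> e \<ominus> e \<oplus> e \<otimes> e" unfolding f_def using e(1) by algebra
    also have "\<dots> = f" unfolding e(2) f_def using e(1) by algebra
    finally show ?thesis .
  qed
  have ef: "e \<otimes> f = \<zero>"
  proof -
    have "e \<otimes> f = e \<ominus> e \<otimes> e" unfolding f_def using e(1) by algebra
    then show ?thesis using e by (simp add: a_minus_def r_neg)
  qed
  have f0: "f \<noteq> \<zero>"
    using ne e(1) by (metis f_def a_minus_def a_inv_closed add.inv_equality minus_minus one_closed)
  have sf: "s f = f" using e by (simp add: f_def s_add s_minus s_one a_minus_def)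
  obtain w where w: "w \<in> fixed u" and nil: "\<And>k::nat. k > 0 \<Longrightarrow> (f \<otimes> w) [^] k \<noteq> \<zero>"
    using fixed_not_nilpotent[OF u f ff f0] by blast
  define z where "z = f \<otimes> w"
  have wc: "w \<in> carrier R" "u \<otimes> s w = w" using w by (auto simp: fixed_def)
  have z: "z \<in> carrier R" using wc f by (simp add: z_def)
  have uz: "u \<otimes> s z = z"
  proof -
    have "u \<otimes> s z = f \<otimes> (u \<otimes> s w)" using wc f u sf by (simp add: z_def s_mult m_lcomm)
    then show ?thesis using wc by (simp add: z_def)
  qed
  obtain k :: nat where k: "k > 0" "z [^] k \<otimes> z [^] k = z [^] k"
    using finite_pow_idempotent[OF fin z] by blast
  define g where "g = z [^] k"
  have g: "g \<in> carrier R" "g \<otimes> g = g" "g \<noteq> \<zero>"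
    using z k nil[OF k(1)] by (auto simp: g_def z_def)
  have ez: "e \<otimes> z = \<zero>" using ef e f wc by (simp add: z_def m_assoc[symmetric])
  obtain k' where k': "k = Suc k'" using k(1) gr0_implies_Suc by blast
  have gz: "g = z [^] k' \<otimes> z" by (simp add: g_def k')
  have eg: "e \<otimes> g = \<zero>"
    unfolding gz using e z ez by (simp add: m_lcomm[of e])
  \<comment> \<open>Since \<open>u \<otimes> s z = z\<close>, the idempotents \<open>g\<close> and
    \<open>s g\<close> divide each other, and idempotents that divide each other are equal.\<close>
  have sg: "s g = g"
  proof -
    have zz: "z [^] k = u [^] k \<otimes> s z [^] k"
      using nat_pow_distrib[of u "s z" k] uz u z by simp
    have 1: "g = u [^] k \<otimes> s g" unfolding g_def s_pow[OF z] by (rule zz)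
    have sgg: "s g \<otimes> s g = s g" using g s_mult by metis
    have uk: "u [^] k \<otimes> s (u [^] k) = \<one>"
      using u nat_pow_distrib[of u "s u" k] by (simp add: s_pow)
    have 2: "s g = s (u [^] k) \<otimes> g"
    proof -
      have "s g = s (u [^] k \<otimes> s g)" using 1 by simp
      then show ?thesis using u g by (simp add: s_mult s_s)
    qed
    have "g \<otimes> s g = g \<otimes> (s (u [^] k) \<otimes> g)" using 2 by simp
    also have "\<dots> = s (u [^] k) \<otimes> (g \<otimes> g)" using u g by (simp add: m_lcomm[of g])
    finally have 3: "g \<otimes> s g = s g" using g 2 by simp
    have "g \<otimes> s g = (u [^] k \<otimes> s g) \<otimes> s g" using 1 by simp
    also have "\<dots> = u [^] k \<otimes> (s g \<otimes> s g)" using u g by (simp add: m_assoc)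
    also have "\<dots> = g" unfolding sgg by (rule 1[symmetric])
    finally show ?thesis using 3 by simp
  qed
  define e' where "e' = e \<oplus> g"
  define x' where "x' = x \<oplus> g \<otimes> z"
  have ge: "g \<otimes> e = \<zero>" using eg e g by (simp add: m_comm)
  have ze: "z \<otimes> e = \<zero>" using ez e z by (simp add: m_comm)
  have gx: "g \<otimes> x = \<zero>"
  proof -
    have "g \<otimes> x = g \<otimes> (e \<otimes> x)" using x by simp
    also have "\<dots> = (g \<otimes> e) \<otimes> x" using x e g by (simp add: m_assoc)
    finally show ?thesis using ge x by simp
  qed
  have "partial_unit u e' x'"
    unfolding partial_unit_def
  proof (intro conjI bexI)
    show "e' \<in> carrier R" using e g by (simp add: e'_def)
    have "e' \<otimes> e' = e \<otimes> e \<oplus> e \<otimes> g \<oplus> g \<otimes> e \<oplus> g \<otimes> g"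
      unfolding e'_def using e(1) g(1) by algebra
    then show "e' \<otimes> e' = e'" using e g eg ge by (simp add: e'_def)
    show "s e' = e'" using e g sg by (simp add: e'_def s_add)
    have "u \<otimes> s x' = u \<otimes> s x \<oplus> g \<otimes> (u \<otimes> s z)"
      using u x g z sg by (simp add: x'_def s_add s_mult r_distr m_lcomm)
    then show "x' \<in> fixed u" using x uz g z by (simp add: fixed_def x'_def)
    have "e' \<otimes> x' = e \<otimes> x \<oplus> g \<otimes> (e \<otimes> z) \<oplus> g \<otimes> x \<oplus> (g \<otimes> g) \<otimes> z"
      unfolding e'_def x'_def using e(1) g(1) x(1) z by algebra
    then show "e' \<otimes> x' = x'" using e g x z eg ge gx ez by (simp add: x'_def)
    \<comment> \<open>The inverse of \<open>x'\<close> relative to \<open>e'\<close> is assembled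
      from \<open>y\<close> on the factor of \<open>e\<close> and \<open>z [^] k'\<close> on the
      factor of \<open>g\<close>, where \<open>z [^] k' \<otimes> z = g\<close>.\<close>
    show "y \<otimes> e \<oplus> z [^] k' \<otimes> g \<in> carrier R" using y e z g by simp
    have "x' \<otimes> (y \<otimes> e \<oplus> z [^] k' \<otimes> g)
        = (x \<otimes> y) \<otimes> e \<oplus> (g \<otimes> x) \<otimes> z [^] k' \<oplus> g \<otimes> y \<otimes> (z \<otimes> e) \<oplus> g \<otimes> g \<otimes> (z [^] k' \<otimes> z)"
    proof -
      have "z [^] k' \<in> carrier R" using z by simp
      then show ?thesis unfolding x'_def using y(1) e(1) z g(1) x(1) by algebra
    qed
    also have "\<dots> = e'" using e g x y z gx ze by (simp add: gz[symmetric] e'_def)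
    finally show "x' \<otimes> (y \<otimes> e \<oplus> z [^] k' \<otimes> g) = e'" .
  qed
  moreover have "card ((\<otimes>) e ` carrier R) < card ((\<otimes>) e' ` carrier R)"
  proof (rule psubset_card_mono)
    show "finite ((\<otimes>) e' ` carrier R)" using fin by simp
    show "(\<otimes>) e ` carrier R \<subset> (\<otimes>) e' ` carrier R"
    proof
      show "(\<otimes>) e ` carrier R \<subseteq> (\<otimes>) e' ` carrier R"
      proof
        fix v assume "v \<in> (\<otimes>) e ` carrier R"
        then obtain b where b: "b \<in> carrier R" "v = e \<otimes> b" by blast
        have "e' \<otimes> (e \<otimes> b) = (e \<otimes> e \<oplus> g \<otimes> e) \<otimes> b"
          unfolding e'_def using e(1) g(1) b(1) by algebra
        then have "v = e' \<otimes> (e \<otimes> b)" using b e ge by simp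
        then show "v \<in> (\<otimes>) e' ` carrier R" using b e by blast
      qed
      have "g = e' \<otimes> g" using e g eg by (simp add: e'_def l_distr)
      then have "g \<in> (\<otimes>) e' ` carrier R" using g by blast
      moreover have "g \<notin> (\<otimes>) e ` carrier R"
      proof
        assume "g \<in> (\<otimes>) e ` carrier R"
        then obtain b where b: "b \<in> carrier R" "g = e \<otimes> b" by blast
        then have "e \<otimes> g = g" using e by (simp add: m_assoc[symmetric])
        then show False using eg g by simp
      qed
      ultimately show "(\<otimes>) e ` carrier R \<noteq> (\<otimes>) e' ` carrier R" by blast
    qed
  qed
  ultimately show ?thesis using that by blast
qed

text \<open>Start from the partial unit at \<open>\<zero>\<close> and extend until
  \<open>e = \<one>\<close>. The ideal generated by \<open>e\<close> grows each time and is bounded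
  by the finite ring, so the process ends.\<close>

lemma hilbert90:
  assumes u: "u \<in> carrier R" "u \<otimes> s u = \<one>"
  obtains x where "x \<in> Units R" "u \<otimes> s x = x"
proof -
  let ?m = "\<lambda>e. card ((\<otimes>) e ` carrier R)"
  have "\<exists>x. partial_unit u \<one> x" if "partial_unit u e x" for e x
    using that
  proof (induction "card (carrier R) - ?m e" arbitrary: e x rule: less_induct)
    case less
    show ?case
    proof (cases "e = \<one>")
      case False
      then obtain e' x' where e': "partial_unit u e' x'" "?m e < ?m e'"
        using partial_unit_extend[OF u less.prems] by blast
      have "?m e' \<le> card (carrier R)" using fin by (rule card_image_le)
      then show ?thesis using less.hyps[OF _ e'(1)] e'(2) by simp
    qed (use less in auto)
  qed
  moreover have "partial_unit u \<zero> \<zero>"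
    using u by (auto simp: partial_unit_def fixed_def s_zero)
  ultimately obtain x where x: "partial_unit u \<one> x" by blast
  then obtain y where "x \<in> carrier R" "u \<otimes> s x = x" "y \<in> carrier R" "x \<otimes> y = \<one>"
    unfolding partial_unit_def fixed_def by blast
  then have "x \<in> Units R" unfolding Units_def using m_comm[of x y] by auto
  then show ?thesis using that \<open>u \<otimes> s x = x\<close> by blast
qed

text \<open>By Hilbert 90 the kernel of \<open>x \<mapsto> x \<otimes> s x\<close> on the units is the image of \<open>x \<mapsto> x \<otimes> inv (s x)\<close>;
  counting both homomorphisms by kernel and image gives surjectivity of the first.\<close>
theorem norm_surj:
  assumes h: "h \<in> Units R" "s h = h"
  obtains x where "x \<in> Units R" "x \<otimes> s x = h"
proof -
  let ?U = "units_of R"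
  interpret U: comm_group ?U by (rule units_comm_group)
  have U_simps: "carrier ?U = Units R" "mult ?U = mult R" "one ?U = \<one>"
    by (simp_all add: units_of_carrier units_of_mult units_of_one)
  have inv_U: "\<And>x. x \<in> Units R \<Longrightarrow> inv\<^bsub>?U\<^esub> x = inv x" by (rule units_of_inv)
  have sU: "s x \<in> Units R" if x: "x \<in> Units R" for x
  proof -
    have "s x \<otimes> s (inv x) = \<one>" "s (inv x) \<otimes> s x = \<one>"
      using x by (simp_all add: s_mult[symmetric] s_one Units_closed)
    moreover have "s x \<in> carrier R" "s (inv x) \<in> carrier R" using x by (simp_all add: Units_closed)
    ultimately show ?thesis unfolding Units_def by blast
  qed
  have finU: "finite (carrier ?U)"
    using fin Units_closed by (auto simp: U_simps intro: finite_subset)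
  define nu where "nu = (\<lambda>x. x \<otimes> s x)"
  define de where "de = (\<lambda>x. x \<otimes> inv (s x))"
  have nu: "nu \<in> hom ?U ?U"
    unfolding hom_def U_simps
    by (auto simp: nu_def sU Units_closed s_mult m_ac)
  have de: "de \<in> hom ?U ?U"
  proof -
    have "x \<otimes> y \<otimes> inv (s x \<otimes> s y) = x \<otimes> inv (s x) \<otimes> (y \<otimes> inv (s y))"
      if "x \<in> Units R" "y \<in> Units R" for x y
    proof -
      have "inv (s x \<otimes> s y) = inv (s x) \<otimes> inv (s y)"
        using U.inv_mult[of "s x" "s y"] that sU by (simp add: U_simps inv_U)
      then show ?thesis using that sU by (simp add: m_ac Units_closed)
    qed
    then show ?thesis unfolding hom_def U_simps
      by (auto simp: de_def sU Units_closed s_mult)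
  qed
  have kd: "{x \<in> carrier ?U. de x = \<one>\<^bsub>?U\<^esub>} = {x \<in> Units R. s x = x}"
  proof -
    have "de x = \<one> \<longleftrightarrow> s x = x" if x: "x \<in> Units R" for x
    proof
      assume "de x = \<one>"
      then have "x \<otimes> inv (s x) \<otimes> s x = s x" using x sU by (simp add: de_def Units_closed)
      then show "s x = x" using x sU by (simp add: m_assoc Units_closed)
    next
      assume "s x = x"
      then show "de x = \<one>" using x by (simp add: de_def)
    qed
    then show ?thesis by (auto simp: U_simps)
  qed
  have id: "de ` carrier ?U = {x \<in> carrier ?U. nu x = \<one>\<^bsub>?U\<^esub>}"
  proof
    show "de ` carrier ?U \<subseteq> {x \<in> carrier ?U. nu x = \<one>\<^bsub>?U\<^esub>}"
    proof
      fix v assume "v \<in> de ` carrier ?U"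
      then obtain x where x: "x \<in> Units R" "v = x \<otimes> inv (s x)" by (auto simp: U_simps de_def)
      have "s (inv (s x)) \<otimes> x = \<one>"
      proof -
        have "s (inv (s x)) \<otimes> s (s x) = \<one>"
          using x sU by (simp add: s_mult[symmetric] s_one Units_closed)
        then show ?thesis using x by (simp add: s_s Units_closed)
      qed
      moreover have "v \<otimes> s v = (s x \<otimes> inv (s x)) \<otimes> (s (inv (s x)) \<otimes> x)"
      proof -
        have "x \<in> carrier R" "s x \<in> carrier R" "inv (s x) \<in> carrier R" "s (inv (s x)) \<in> carrier R"
          using x(1) sU by (simp_all add: Units_closed)
        then show ?thesis unfolding x(2) by (simp add: s_mult s_s m_ac del: Units_r_inv Units_l_inv)
      qed
      ultimately have "v \<otimes> s v = \<one>" using x sU by (simp add: Units_closed)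
      then show "v \<in> {x \<in> carrier ?U. nu x = \<one>\<^bsub>?U\<^esub>}"
        using x sU by (simp add: U_simps nu_def)
    qed
    show "{x \<in> carrier ?U. nu x = \<one>\<^bsub>?U\<^esub>} \<subseteq> de ` carrier ?U"
    proof
      fix v assume "v \<in> {x \<in> carrier ?U. nu x = \<one>\<^bsub>?U\<^esub>}"
      then have v: "v \<in> Units R" "v \<otimes> s v = \<one>" by (auto simp: U_simps nu_def)
      then obtain x where x: "x \<in> Units R" "v \<otimes> s x = x" using hilbert90[of v] by blast
      have "v = v \<otimes> s x \<otimes> inv (s x)" using v x(1) sU by (simp add: m_assoc Units_closed)
      then have "v = de x" by (simp add: x(2) de_def)
      then show "v \<in> de ` carrier ?U" using x by (simp add: U_simps)
    qed
  qed
  have 1: "card (nu ` carrier ?U) * card (de ` carrier ?U) = card (carrier ?U)"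
    using U.card_image_times_kernel[OF finU nu] id by simp
  have 2: "card (de ` carrier ?U) * card {x \<in> Units R. s x = x} = card (carrier ?U)"
    using U.card_image_times_kernel[OF finU de] kd by simp
  have "card (de ` carrier ?U) > 0" using finU U.one_closed by (auto simp: card_gt_0_iff)
  moreover have "card (de ` carrier ?U) * card (nu ` carrier ?U)
      = card (de ` carrier ?U) * card {x \<in> Units R. s x = x}"
    using 1 2 by (simp add: mult.commute)
  ultimately have "card (nu ` carrier ?U) = card {x \<in> Units R. s x = x}" by simp
  moreover have "nu ` carrier ?U \<subseteq> {x \<in> Units R. s x = x}"
    using sU by (auto simp: U_simps nu_def s_mult s_s Units_closed m_comm)
  moreover have "finite {x \<in> Units R. s x = x}" using finU by (simp add: U_simps)
  ultimately have "nu ` carrier ?U = {x \<in> Units R. s x = x}" by (metis card_subset_eq)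
  then have "h \<in> nu ` carrier ?U" using h by blast
  then show ?thesis using that by (auto simp: U_simps nu_def)
qed

end

section \<open>Sesquilinear congruence of matrices with equal asymmetry\<close>

text \<open>That \<open>q\<close> is a prime power is represented by additivity of the
  \<open>q\<close>-th power; \<open>ty\<close> names the field type.\<close>

locale frobenius_field =
  fixes q n :: nat and ty :: "'a::{field,finite} itself"
  assumes frob_add: "\<And>x y :: 'a. (x + y) ^ q = x ^ q + y ^ q"
    and q_gt_1: "q > 1"
    and n_pos: "n > 0"
    and card_field: "card (UNIV :: 'a set) = q ^ (2 * n)"
begin

lemma q_pos: "q > 0"
  using q_gt_1 by simp

sublocale frob: comm_ring_hom "\<lambda>x :: 'a. x ^ q"
  by unfold_locales (use q_pos in \<open>auto simp: frob_add power_mult_distrib power_0_left\<close>)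

section \<open>The conjugate transpose\<close>

lemma star_mat_eq: "star_mat q (A :: 'a mat) = transpose_mat (map_mat (\<lambda>x. x ^ q) A)"
  by (rule eq_matI) (auto simp: star_mat_def)

lemma star_mat_carrier [simp, intro]:
  "(A :: 'a mat) \<in> carrier_mat m k \<Longrightarrow> star_mat q A \<in> carrier_mat k m"
  by (auto simp: star_mat_def)

lemma star_mat_mult:
  assumes "(A :: 'a mat) \<in> carrier_mat m k" "B \<in> carrier_mat k l"
  shows "star_mat q (A * B) = star_mat q B * star_mat q A"
  using assms unfolding star_mat_eq
  by (subst frob.mat_hom_mult[OF assms]) (auto intro!: transpose_mult)

lemma star_mat_add:
  assumes "(A :: 'a mat) \<in> carrier_mat m k" "B \<in> carrier_mat m k"
  shows "star_mat q (A + B) = star_mat q A + star_mat q B"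
  by (rule eq_matI) (use assms in \<open>auto simp: star_mat_def frob_add\<close>)

lemma star_mat_one [simp]: "star_mat q (1\<^sub>m m) = (1\<^sub>m m :: 'a mat)"
  by (rule eq_matI) (use q_pos in \<open>auto simp: star_mat_def\<close>)

lemma star_mat_zero [simp]: "star_mat q (0\<^sub>m m k) = (0\<^sub>m k m :: 'a mat)"
  by (rule eq_matI) (use q_pos in \<open>auto simp: star_mat_def\<close>)

lemma star_mat_uminus:
  "(A :: 'a mat) \<in> carrier_mat m k \<Longrightarrow> star_mat q (- A) = - star_mat q A"
  by (rule eq_matI) (auto simp: star_mat_def frob.hom_uminus)

lemma star_mat_smult: "star_mat q (a \<cdot>\<^sub>m (A :: 'a mat)) = a ^ q \<cdot>\<^sub>m star_mat q A"
  by (rule eq_matI) (auto simp: star_mat_def power_mult_distrib)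

text \<open>Applying \<open>star_mat\<close> twice undoes the transposition and raises the entries
  to the power \<open>q^2\<close>. Having entries in the subfield thus becomes an equation that is
  easily carried through products and inverses.\<close>

lemma subF_mat_iff_star_star:
  assumes "(A :: 'a mat) \<in> carrier_mat n n"
  shows "(\<forall>i<n. \<forall>j<n. A $$ (i, j) \<in> subF q) \<longleftrightarrow> star_mat q (star_mat q A) = A"
proof -
  have "star_mat q (star_mat q A) = A \<longleftrightarrow> (\<forall>i<n. \<forall>j<n. star_mat q (star_mat q A) $$ (i, j) = A $$ (i, j))"
  proof (intro iffI eq_matI)
    assume "\<forall>i<n. \<forall>j<n. star_mat q (star_mat q A) $$ (i, j) = A $$ (i, j)"
    then show "star_mat q (star_mat q A) $$ (i, j) = A $$ (i, j)" if "i < dim_row A" "j < dim_col A" for i j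
      using that assms by auto
  qed (use assms in \<open>auto simp: star_mat_def\<close>)
  also have "\<dots> \<longleftrightarrow> (\<forall>i<n. \<forall>j<n. A $$ (i, j) \<in> subF q)"
    using assms by (simp add: star_mat_def subF_def power_mult[symmetric] power2_eq_square)
  finally show ?thesis by simp
qed

abbreviation M :: "'a mat set" where "M \<equiv> carrier_mat n n"

lemma M_mult [simp, intro]: "\<lbrakk>A \<in> M; B \<in> M\<rbrakk> \<Longrightarrow> A * B \<in> M"
  by (rule mult_carrier_mat)

lemma M_assoc: "\<lbrakk>A \<in> M; B \<in> M; C \<in> M\<rbrakk> \<Longrightarrow> A * B * C = A * (B * C)"
  by (rule assoc_mult_mat)

lemma M_neutral [simp]:
  assumes "A \<in> M"
  shows "A * 1\<^sub>m n = A" "1\<^sub>m n * A = A" "A * 0\<^sub>m n n = 0\<^sub>m n n" "0\<^sub>m n n * A = 0\<^sub>m n n"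
  using assms by auto

lemma M_uminus [simp]:
  assumes "A \<in> M" "B \<in> M"
  shows "- A * B = - (A * B)" "A * - B = - (A * B)"
  using assms by auto

lemma M_cancel:
  assumes "A \<in> M" "B \<in> M" "C \<in> M" "A * B = 1\<^sub>m n" shows "A * (B * C) = C"
  using assms by (simp add: M_assoc[symmetric])

lemma finite_M: "finite M"
proof -
  have "inj_on (\<lambda>A. \<lambda>ij\<in>{..<n} \<times> {..<n}. A $$ ij) M"
  proof (rule inj_onI)
    fix A B :: "'a mat" assume AB: "A \<in> M" "B \<in> M"
      and eq: "(\<lambda>ij\<in>{..<n} \<times> {..<n}. A $$ ij) = (\<lambda>ij\<in>{..<n} \<times> {..<n}. B $$ ij)"
    show "A = B"
    proof (rule eq_matI)
      fix i j assume "i < dim_row B" "j < dim_col B"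
      then have "(i, j) \<in> {..<n} \<times> {..<n}" using AB by auto
      then show "A $$ (i, j) = B $$ (i, j)" using fun_cong[OF eq, of "(i, j)"] by simp
    qed (use AB in auto)
  qed
  moreover have "(\<lambda>A. \<lambda>ij\<in>{..<n} \<times> {..<n}. A $$ ij) ` M
      \<subseteq> ({..<n} \<times> {..<n}) \<rightarrow>\<^sub>E (UNIV :: 'a set)" by (rule image_subsetI) (rule restrict_PiE_iff[THEN iffD2], simp)
  moreover have "finite (({..<n} \<times> {..<n}) \<rightarrow>\<^sub>E (UNIV :: 'a set))" by (simp add: finite_PiE)
  ultimately show ?thesis by (meson finite_imageD finite_subset)
qed

text \<open>The congruence sought amounts to \<open>X * dag X = H\<close>. The map
  \<open>dag\<close> reverses products and its square is conjugation by \<open>A\<close>, so it is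
  no ring involution on all matrices; it becomes one on the commutative ring \<open>B\<close>, whose
  elements commute with \<open>A\<close>, and there \<open>norm_surj\<close> solves the
  equation.\<close>

lemma congruent_if_same_asymmetry:
  fixes C0 C D0 D A :: "'a mat" and \<gamma> :: 'a
  assumes \<gamma>: "\<gamma> \<in> subF q" "\<gamma> ^ q \<noteq> \<gamma>"
    and cM [simp]: "C0 \<in> M" "C \<in> M" "D0 \<in> M" "D \<in> M" "A \<in> M"
    and K [simp]: "star_mat q (star_mat q C0) = C0" "star_mat q (star_mat q C) = C"
    and inv0: "C0 * D0 = 1\<^sub>m n" "D0 * C0 = 1\<^sub>m n"
    and inv1: "C * D = 1\<^sub>m n" "D * C = 1\<^sub>m n"
    and asym: "star_mat q C0 = A * C0" "star_mat q C = A * C"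
  obtains X Y where "X \<in> M" "Y \<in> M" "X * Y = 1\<^sub>m n" "Y * X = 1\<^sub>m n"
    "star_mat q (star_mat q X) = X" "C = X * C0 * star_mat q X"
proof -
  note [simp] = M_assoc M_cancel[OF _ _ _ inv0(1)] M_cancel[OF _ _ _ inv0(2)]
    M_cancel[OF _ _ _ inv1(1)] M_cancel[OF _ _ _ inv1(2)] inv0 inv1
  \<comment> \<open>This is the inverse of \<open>A\<close>, written so that it appears directly
    when \<open>dag\<close> is applied to \<open>H\<close>.\<close>
  define A' where "A' = C0 * star_mat q D0"
  define H where "H = C * D0"
  define H' where "H' = C0 * D"
  \<comment> \<open>The adjoint for the form with matrix \<open>C0\<close>: it satisfies
    \<open>dag X * C0 = C0 * star_mat q X\<close>.\<close>
  define dag where "dag X = C0 * (star_mat q X * D0)" for X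
  have [simp]: "A' \<in> M" "H \<in> M" "H' \<in> M" by (auto simp: A'_def H_def H'_def)
  have dag_c [simp]: "dag X \<in> M" if "X \<in> M" for X using that by (simp add: dag_def)
  have st [simp]: "star_mat q (X * Y) = star_mat q Y * star_mat q X" if "X \<in> M" "Y \<in> M" for X Y
    using star_mat_mult that by blast
  have s0: "star_mat q D0 * star_mat q C0 = 1\<^sub>m n" "star_mat q C0 * star_mat q D0 = 1\<^sub>m n"
    using cM inv0 by (metis st star_mat_one)+
  have A_eq: "A = star_mat q C0 * D0" by (simp add: asym)
  have AA': "A * A' = 1\<^sub>m n"
  proof -
    have "A * A' = star_mat q C0 * star_mat q D0" by (simp add: A'_def asym)
    then show ?thesis using s0 by simp
  qed
  have A'A: "A' * A = 1\<^sub>m n"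
    by (simp add: A'_def A_eq M_cancel[OF _ _ _ s0(1)])
  note [simp] = AA' A'A M_cancel[OF _ _ _ AA'] M_cancel[OF _ _ _ A'A]
  have K_inv: "star_mat q (star_mat q Y) = Y" if "X \<in> M" "Y \<in> M" "X * Y = 1\<^sub>m n" "Y * X = 1\<^sub>m n"
    "star_mat q (star_mat q X) = X" for X Y
  proof -
    have e: "X * star_mat q (star_mat q Y) = star_mat q (star_mat q (X * Y))"
      using that(1,2,5) by simp
    have "X * star_mat q (star_mat q Y) = 1\<^sub>m n" unfolding e that(3) by simp
    then have "Y * (X * star_mat q (star_mat q Y)) = Y" using that by simp
    then show ?thesis using that by (simp add: M_cancel[OF _ _ _ that(4)])
  qed
  have [simp]: "star_mat q (star_mat q D0) = D0" "star_mat q (star_mat q D) = D"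
    using K_inv[of C0 D0] K_inv[of C D] by simp_all
  have KA [simp]: "star_mat q (star_mat q A) = A" unfolding A_eq by simp
  have KA' [simp]: "star_mat q (star_mat q A') = A'" unfolding A'_def by simp
  have KH [simp]: "star_mat q (star_mat q H) = H" "star_mat q (star_mat q H') = H'"
    unfolding H_def H'_def by simp_all
  have HH' [simp]: "H * H' = 1\<^sub>m n" "H' * H = 1\<^sub>m n" by (simp_all add: H_def H'_def)
  have dag_mult: "dag (X * Y) = dag Y * dag X" if "X \<in> M" "Y \<in> M" for X Y
    using that by (simp add: dag_def)
  have dag_add: "dag (X + Y) = dag X + dag Y" if "X \<in> M" "Y \<in> M" for X Y
    using that by (simp add: dag_def star_mat_add[of _ n n] add_mult_distrib_mat[of _ n n _ _ n]
        mult_add_distrib_mat[of _ n n _ n])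
  have dag_dag: "dag (dag X) = A' * (X * A)" if "X \<in> M" "star_mat q (star_mat q X) = X" for X
    using that by (simp add: dag_def A'_def A_eq)
  have dag_K: "star_mat q (star_mat q (dag X)) = dag X" if "X \<in> M" "star_mat q (star_mat q X) = X" for X
    using that by (simp add: dag_def)
  \<comment> \<open>Equality of the asymmetries enters here: in \<open>star_mat q C = A * C\<close>
    the factor \<open>A\<close> cancels against \<open>A'\<close>.\<close>
  have dag_H: "dag H = H"
  proof -
    have "dag H = A' * (star_mat q C * D0)" by (simp add: dag_def H_def A'_def)
    then show ?thesis by (simp add: asym H_def)
  qed
  \<comment> \<open>Being fixed by \<open>dag\<close>, \<open>H\<close> is fixed by its square,
    which is conjugation by \<open>A\<close>.\<close>
  have AH: "A * H = H * A"
  proof -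
    have "H = A' * (H * A)" using dag_dag[of H] dag_H by simp
    then have "A * H = A * (A' * (H * A))" by simp
    then show ?thesis by simp
  qed
  have A'H: "A' * H = H * A'"
  proof -
    have "A' * H = A' * (H * (A * A'))" by simp
    also have "\<dots> = A' * ((H * A) * A')" by simp
    also have "\<dots> = H * A'" unfolding AH[symmetric] by simp
    finally show ?thesis .
  qed
  \<comment> \<open>\<open>Ce\<close> is the centralizer of \<open>H\<close> over the subfield and
    \<open>B\<close> is the centre of \<open>Ce\<close>. So \<open>B\<close> is commutative and
    contains \<open>H\<close>, and it commutes with \<open>A\<close> because \<open>A\<close> lies
    in \<open>Ce\<close>.\<close>
  define Ce where "Ce = {X \<in> M. star_mat q (star_mat q X) = X \<and> X * H = H * X}"
  define B where "B = {X \<in> Ce. \<forall>Z\<in>Ce. X * Z = Z * X}"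
  have CeM: "X \<in> M" if "X \<in> Ce" for X using that by (simp add: Ce_def)
  have BM: "X \<in> M" if "X \<in> B" for X using that by (simp add: B_def CeM)
  have Ce_mult: "X * Y \<in> Ce" if "X \<in> Ce" "Y \<in> Ce" for X Y
  proof -
    have X: "X \<in> M" "Y \<in> M" "X * H = H * X" "Y * H = H * Y"
      using that by (simp_all add: Ce_def)
    have "X * Y * H = X * (Y * H)" using X(1,2) by simp
    also have "\<dots> = (X * H) * Y" unfolding X(4) using X(1,2) by simp
    also have "\<dots> = H * (X * Y)" unfolding X(3) using X(1,2) by simp
    finally show ?thesis using that by (simp add: Ce_def)
  qed
  have Ce_A: "A \<in> Ce" "A' \<in> Ce" "H \<in> Ce" using AH A'H by (simp_all add: Ce_def)
  have Ce_dag: "dag X \<in> Ce" if "X \<in> Ce" for X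
  proof -
    have X: "X \<in> M" "star_mat q (star_mat q X) = X" "X * H = H * X" using that by (simp_all add: Ce_def)
    have "dag X * H = dag (H * X)" using dag_mult X dag_H by simp
    also have "\<dots> = H * dag X" using dag_mult X dag_H by (simp flip: X(3))
    finally show ?thesis using X dag_K by (simp add: Ce_def)
  qed
  have B_mult: "X * Y \<in> B" if XY: "X \<in> B" "Y \<in> B" for X Y
  proof -
    have "X * Y * Z = Z * (X * Y)" if Z: "Z \<in> Ce" for Z
    proof -
      have XZ: "X * Z = Z * X" "Y * Z = Z * Y" using XY Z unfolding B_def by blast+
      have X: "X \<in> M" "Y \<in> M" "Z \<in> M" using XY Z by (simp_all add: BM CeM)
      have "X * Y * Z = X * (Y * Z)" using X by simp
      also have "\<dots> = (X * Z) * Y" unfolding XZ(2) using X by simp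
      also have "\<dots> = Z * (X * Y)" unfolding XZ(1) using X by simp
      finally show ?thesis .
    qed
    then show ?thesis using XY Ce_mult unfolding B_def by blast
  qed
  note distr = add_mult_distrib_mat[of _ n n _ _ n] mult_add_distrib_mat[of _ n n _ n]
  have B_add: "X + Y \<in> B" if "X \<in> B" "Y \<in> B" for X Y
    using that by (auto simp: B_def Ce_def distr star_mat_add[of _ n n])
  have B_uminus: "- X \<in> B" if "X \<in> B" for X
    using that by (auto simp: B_def Ce_def star_mat_uminus[of _ n n])
  have B_zero: "0\<^sub>m n n \<in> B" by (auto simp: B_def Ce_def)
  have B_one: "1\<^sub>m n \<in> B" by (auto simp: B_def Ce_def)
  have B_scalar: "c \<cdot>\<^sub>m 1\<^sub>m n \<in> B" if "c \<in> subF q" for c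
  proof -
    have "(c ^ q) ^ q = c" using that by (simp add: subF_def power_mult[symmetric] power2_eq_square)
    then show ?thesis by (auto simp: B_def Ce_def star_mat_smult
          mult_smult_assoc_mat[of _ n n _ n] mult_smult_distrib[of _ n n _ n])
  qed
  have B_comm: "X * Y = Y * X" if "X \<in> B" "Y \<in> B" for X Y
    using that unfolding B_def by blast
  have B_dag: "dag X \<in> B" if X: "X \<in> B" for X
  proof -
    have "dag X * Y = Y * dag X" if Y: "Y \<in> Ce" for Y
    proof -
      have YM: "Y \<in> M" "star_mat q (star_mat q Y) = Y" using Y by (simp_all add: Ce_def)
      \<comment> \<open>A preimage of \<open>Y\<close> under \<open>dag\<close>, found from the
        formula for \<open>dag (dag W)\<close>. Commutation of \<open>X\<close> with
        \<open>Z\<close> then turns into commutation of \<open>dag X\<close> with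
        \<open>Y\<close>.\<close>
      define Z where "Z = dag (A * (Y * A'))"
      have Z: "Z \<in> Ce" using Ce_dag Ce_mult Ce_A Y by (simp add: Z_def)
      have dZ: "dag Z = Y" unfolding Z_def using dag_dag[of "A * (Y * A')"] YM by simp
      have "X * Z = Z * X" using X Z by (simp add: B_def)
      then have "dag (X * Z) = dag (Z * X)" by simp
      then show ?thesis using dag_mult X Z dZ by (simp add: BM CeM)
    qed
    then show ?thesis using X Ce_dag by (simp add: B_def)
  qed
  have B_dag_dag: "dag (dag X) = X" if X: "X \<in> B" for X
  proof -
    have "X * A = A * X" using X Ce_A by (simp add: B_def)
    then show ?thesis using dag_dag[of X] X by (simp add: B_def Ce_def)
  qed
  define R :: "'a mat ring" where "R = \<lparr>carrier = B, mult = (*), one = 1\<^sub>m n, zero = 0\<^sub>m n n, add = ((+) :: 'a mat \<Rightarrow> 'a mat \<Rightarrow> 'a mat)\<rparr>"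
  have R_simps [simp]: "carrier R = B" "mult R = (*)" "one R = 1\<^sub>m n" "zero R = 0\<^sub>m n n" "add R = (+)"
    by (simp_all add: R_def)
  \<comment> \<open>On scalar matrices over the subfield \<open>dag\<close> is the
    \<open>q\<close>-th power map, which moves \<open>\<gamma>\<close>; this provides the element
    required by \<open>separable\<close>.\<close>
  define c where "c = \<gamma> \<cdot>\<^sub>m (1\<^sub>m n :: 'a mat)"
  define d where "d = inverse (\<gamma> ^ q - \<gamma>) \<cdot>\<^sub>m (1\<^sub>m n :: 'a mat)"
  have R: "cring R"
  proof (rule cringI)
    show "abelian_group R"
    proof (rule abelian_groupI)
      fix X assume "X \<in> carrier R"
      then show "\<exists>Y\<in>carrier R. Y \<oplus>\<^bsub>R\<^esub> X = \<zero>\<^bsub>R\<^esub>"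
        using B_uminus BM by (auto intro!: bexI[of _ "- X"] uminus_l_inv_mat)
    qed (auto simp: B_add B_zero BM intro!: assoc_add_mat[of _ n n] comm_add_mat[of _ n n] left_add_zero_mat[of _ n n])
    show "Group.comm_monoid R"
      by (rule comm_monoidI) (auto simp: B_mult B_one BM intro: B_comm)
  qed (auto simp: BM distr)
  interpret R: cring R by (rule R)
  interpret R: finite_involution_ring R dag c d
  proof
    show "finite (carrier R)" using finite_M by (rule rev_finite_subset) (auto simp: BM)
    show "c \<in> carrier R" using \<gamma> B_scalar by (simp add: c_def)
    have "inverse (\<gamma> ^ q - \<gamma>) \<in> subF q"
    proof -
      have "(\<gamma> ^ q - \<gamma>) ^ (q^2) = \<gamma> ^ q - \<gamma>"
      proof -
        have "(\<gamma> ^ q) ^ q = \<gamma>" using \<gamma>(1) by (simp add: subF_def power_mult[symmetric] power2_eq_square)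
        then have "((\<gamma> ^ q - \<gamma>) ^ q) ^ q = \<gamma> ^ q - \<gamma>" by (simp add: frob.hom_minus)
        then show ?thesis by (simp add: power_mult[symmetric] power2_eq_square)
      qed
      then show ?thesis by (simp add: subF_def power_inverse)
    qed
    then show "d \<in> carrier R" using B_scalar by (simp add: d_def)
    have dc: "dag c = \<gamma> ^ q \<cdot>\<^sub>m 1\<^sub>m n"
      by (simp add: dag_def c_def star_mat_smult mult_smult_assoc_mat[of _ n n _ n] mult_smult_distrib[of _ n n _ n])
    have "\<ominus>\<^bsub>R\<^esub> c = - c"
      using R.minus_equality[of "- c" c] B_uminus \<open>c \<in> carrier R\<close> BM uminus_l_inv_mat[of c n n] by simp
    then have "dag c \<ominus>\<^bsub>R\<^esub> c = (\<gamma> ^ q - \<gamma>) \<cdot>\<^sub>m 1\<^sub>m n"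
      unfolding a_minus_def dc by (auto intro!: eq_matI simp: c_def)
    then show "d \<otimes>\<^bsub>R\<^esub> (dag c \<ominus>\<^bsub>R\<^esub> c) = \<one>\<^bsub>R\<^esub>"
      using \<gamma>(2) by (simp add: d_def mult_smult_assoc_mat[of _ n n _ n] mult_smult_distrib[of _ n n _ n])
        (auto intro!: eq_matI)
  next
    fix X Y assume XY: "X \<in> carrier R" "Y \<in> carrier R"
    show "dag (X \<otimes>\<^bsub>R\<^esub> Y) = dag X \<otimes>\<^bsub>R\<^esub> dag Y"
      using XY dag_mult B_comm B_dag BM by simp
  qed (auto simp: B_dag dag_add BM B_dag_dag)
  \<comment> \<open>The inverse of \<open>H\<close> commutes with everything that commutes with
    \<open>H\<close>, so \<open>H\<close> is a unit in \<open>B\<close> and not merely among all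
    matrices.\<close>
  have H'Z: "H' * Z = Z * H'" if Z: "Z \<in> M" "Z * H = H * Z" for Z
  proof -
    have "H' * Z = H' * (Z * (H * H'))" using Z by simp
    also have "\<dots> = H' * ((Z * H) * H')" using Z(1) by (simp del: HH')
    also have "\<dots> = (H' * H) * (Z * H')" unfolding Z(2) using Z(1) by (simp del: HH')
    finally show ?thesis using Z(1) by simp
  qed
  have "H \<in> B" "H' \<in> B" using Ce_A H'Z by (auto simp: B_def Ce_def)
  then have "H \<in> Units R" unfolding Units_def by (auto intro!: bexI[of _ H'])
  then obtain X where X: "X \<in> Units R" "X * dag X = H" using R.norm_surj[of H] dag_H by auto
  then obtain Y where Y: "X \<in> B" "Y \<in> B" "X * Y = 1\<^sub>m n" "Y * X = 1\<^sub>m n"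
    unfolding Units_def by auto
  have XM: "X \<in> M" using Y BM by blast
  have "C = H * C0" by (simp add: H_def)
  also have "\<dots> = X * C0 * star_mat q X"
    using XM by (simp add: dag_def flip: X(2))
  finally have "C = X * C0 * star_mat q X" .
  moreover have "star_mat q (star_mat q X) = X" using Y(1) unfolding B_def Ce_def by blast
  ultimately show ?thesis using that[of X Y] Y XM BM[OF Y(2)] by blast
qed

end

section \<open>Descent of conjugacy to a subfield\<close>

context frobenius_field begin

lemma subF_iff: "(x::'a) \<in> subF q \<longleftrightarrow> (x ^ q) ^ q = x"
  by (simp add: subF_def power_mult[symmetric] power2_eq_square)

lemma subF_closed [simp, intro]:
  "(0::'a) \<in> subF q" "(1::'a) \<in> subF q"
  "\<lbrakk>x \<in> subF q; (y::'a) \<in> subF q\<rbrakk> \<Longrightarrow> x + y \<in> subF q"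
  "\<lbrakk>x \<in> subF q; (y::'a) \<in> subF q\<rbrakk> \<Longrightarrow> x * y \<in> subF q"
  "(x::'a) \<in> subF q \<Longrightarrow> x ^ q \<in> subF q"
  by (simp_all add: subF_iff frob.hom_add frob.hom_mult)

lemma subF_sum [simp, intro]:
  "(\<And>i. i \<in> I \<Longrightarrow> (f i :: 'a) \<in> subF q) \<Longrightarrow> sum f I \<in> subF q"
  by (induction I rule: infinite_finite_induct) auto

section \<open>Matrices over the subfield and their right ideals\<close>

definition KM :: "'a mat set" where
  "KM = {X \<in> M. \<forall>i<n. \<forall>j<n. X $$ (i, j) \<in> subF q}"

lemma KM_M: "X \<in> KM \<Longrightarrow> X \<in> M"
  by (simp add: KM_def)

lemma KM_iff: "X \<in> KM \<longleftrightarrow> X \<in> M \<and> star_mat q (star_mat q X) = X"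
  using subF_mat_iff_star_star by (auto simp: KM_def)

lemma KM_mult: "\<lbrakk>X \<in> KM; Y \<in> KM\<rbrakk> \<Longrightarrow> X * Y \<in> KM"
  unfolding KM_iff using star_mat_mult[of _ n n _ n] by simp

lemma KM_one: "1\<^sub>m n \<in> KM" and KM_zero: "0\<^sub>m n n \<in> KM"
  by (simp_all add: KM_iff)

text \<open>Applying \<open>star_mat\<close> twice to \<open>X * Y = 1\<^sub>m n\<close> yields
  another right inverse of \<open>X\<close>, which must equal \<open>Y\<close>.\<close>

lemma KM_inverse:
  assumes "X \<in> KM" "Y \<in> M" "X * Y = 1\<^sub>m n" "Y * X = 1\<^sub>m n"
  shows "Y \<in> KM"
proof -
  have X: "X \<in> M" "star_mat q (star_mat q X) = X" using assms(1) by (simp_all add: KM_iff)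
  have e: "X * star_mat q (star_mat q Y) = star_mat q (star_mat q (X * Y))"
    using X assms(2) by (simp add: star_mat_mult[of _ n n _ n])
  have "X * star_mat q (star_mat q Y) = 1\<^sub>m n" unfolding e assms(3) by simp
  then have "Y * (X * star_mat q (star_mat q Y)) = Y" using assms by simp
  then show ?thesis using assms(2) by (simp add: KM_iff M_cancel[OF assms(2) X(1) _ assms(4)])
qed

text \<open>A right ideal of the matrix ring over the subfield encodes the subspace spanned by the columns of
  its elements; \<open>gen X\<close> below encodes the image of \<open>X\<close>.\<close>
definition right_ideals :: "'a mat set set" where
  "right_ideals = {I. I \<subseteq> KM \<and> 0\<^sub>m n n \<in> I \<and> (\<forall>X\<in>I. \<forall>Y\<in>I. X + Y \<in> I)
     \<and> (\<forall>X\<in>I. \<forall>Y\<in>KM. X * Y \<in> I)}"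

definition gen :: "'a mat \<Rightarrow> 'a mat set" where
  "gen X = (\<lambda>Y. X * Y) ` KM"

lemma gen_self: "X \<in> KM \<Longrightarrow> X \<in> gen X"
  unfolding gen_def using KM_one KM_M by (auto intro!: image_eqI[of _ _ "1\<^sub>m n"])

lemma gen_right_ideal: "X \<in> KM \<Longrightarrow> gen X \<in> right_ideals"
proof -
  assume X: "X \<in> KM"
  have "X * Y + X * Z \<in> gen X" if "Y \<in> KM" "Z \<in> KM" for Y Z
  proof -
    have "Y + Z \<in> KM" using that by (auto simp: KM_def)
    moreover have "X * Y + X * Z = X * (Y + Z)"
      using that X KM_M by (intro mult_add_distrib_mat[symmetric, of _ n n _ n]) auto
    ultimately show ?thesis by (auto simp: gen_def)
  qed
  moreover have "X * Y * Z \<in> gen X" if "Y \<in> KM" "Z \<in> KM" for Y Z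
    using that X KM_M KM_mult[of Y Z] by (auto simp: gen_def M_assoc)
  moreover have "0\<^sub>m n n \<in> gen X"
    unfolding gen_def using KM_zero X KM_M by (auto intro!: image_eqI[of _ _ "0\<^sub>m n n"])
  ultimately show ?thesis
    using X KM_mult unfolding right_ideals_def by (auto simp: gen_def)
qed

lemma gen_subset: "\<lbrakk>I \<in> right_ideals; X \<in> I\<rbrakk> \<Longrightarrow> gen X \<subseteq> I"
  by (auto simp: gen_def right_ideals_def)

lemma finite_KM: "finite KM"
  using finite_M by (rule rev_finite_subset) (auto simp: KM_def)

lemma finite_right_ideals: "finite right_ideals"
  by (rule finite_subset[of _ "Pow KM"]) (auto simp: right_ideals_def finite_KM)

section \<open>Counting intertwiners by generated ideal\<close>

definition intertwiners :: "'a mat \<Rightarrow> 'a mat \<Rightarrow> 'a mat set" where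
  "intertwiners A B = {X \<in> KM. X * A = B * X}"

text \<open>For \<open>X\<close> over the subfield, \<open>X \<in> I\<close> holds exactly when
  \<open>gen X \<subseteq> I\<close>, so the intertwiners in \<open>I\<close> are sorted by the
  ideal they generate.\<close>

lemma card_intertwiners_eq_sum:
  assumes I: "I \<in> right_ideals"
  shows "card {X \<in> intertwiners A B. X \<in> I}
    = (\<Sum>J\<in>{J \<in> right_ideals. J \<subseteq> I}. card {X \<in> intertwiners A B. gen X = J})"
proof -
  have fin: "finite (intertwiners A B)"
    using finite_KM by (rule rev_finite_subset) (auto simp: intertwiners_def)
  have "{X \<in> intertwiners A B. X \<in> I}
      = (\<Union>J\<in>{J \<in> right_ideals. J \<subseteq> I}. {X \<in> intertwiners A B. gen X = J})"
    using gen_subset[OF I] gen_self gen_right_ideal by (auto simp: intertwiners_def)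
  also have "card \<dots> = (\<Sum>J\<in>{J \<in> right_ideals. J \<subseteq> I}. card {X \<in> intertwiners A B. gen X = J})"
    using finite_right_ideals fin by (intro card_UN_disjoint) auto
  finally show ?thesis .
qed

text \<open>Inverts the preceding sum by induction along inclusion: the term at \<open>I\<close> is
  the total minus the terms of strictly smaller ideals, which agree by induction.\<close>

lemma card_generators_eq:
  assumes eq: "\<And>I. I \<in> right_ideals \<Longrightarrow>
      card {X \<in> intertwiners A B. X \<in> I} = card {X \<in> intertwiners A' B. X \<in> I}"
    and I: "I \<in> right_ideals"
  shows "card {X \<in> intertwiners A B. gen X = I} = card {X \<in> intertwiners A' B. gen X = I}"
proof -
  have "finite I" using I finite_KM by (auto simp: right_ideals_def intro: finite_subset)
  then show ?thesis using I
  proof (induction I rule: finite_psubset_induct)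
    case (psubset I)
    let ?S = "{J \<in> right_ideals. J \<subset> I}"
    have S: "{J \<in> right_ideals. J \<subseteq> I} = insert I ?S" using psubset.prems by auto
    have "finite ?S" using finite_right_ideals by simp
    then have sp: "card {X \<in> intertwiners C B. X \<in> I} = card {X \<in> intertwiners C B. gen X = I}
        + (\<Sum>J\<in>?S. card {X \<in> intertwiners C B. gen X = J})" for C
      unfolding card_intertwiners_eq_sum[OF psubset.prems] S by simp
    have "(\<Sum>J\<in>?S. card {X \<in> intertwiners A B. gen X = J})
        = (\<Sum>J\<in>?S. card {X \<in> intertwiners A' B. gen X = J})"
      using psubset.IH by (intro sum.cong) auto
    then show ?case using sp[of A] sp[of A'] eq[OF psubset.prems] by simp
  qed
qed

lemma right_ideal_sum:
  fixes N :: nat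
  assumes I: "I \<in> right_ideals" and Z: "\<And>l. l < N \<Longrightarrow> Z l \<in> I"
  shows "mat n n (\<lambda>ij. \<Sum>l<N. Z l $$ ij) \<in> I"
  using Z
proof (induction N)
  case 0
  have "mat n n (\<lambda>ij. \<Sum>l<(0::nat). Z l $$ ij) = 0\<^sub>m n n" by (auto intro!: eq_matI)
  then show ?case using I by (simp add: right_ideals_def)
next
  case (Suc N)
  have "Z N \<in> M" using Suc.prems I KM_M by (auto simp: right_ideals_def)
  then have "mat n n (\<lambda>ij. \<Sum>l<Suc N. Z l $$ ij) = mat n n (\<lambda>ij. \<Sum>l<N. Z l $$ ij) + Z N"
    by (auto intro!: eq_matI)
  moreover have "mat n n (\<lambda>ij. \<Sum>l<N. Z l $$ ij) \<in> I" "Z N \<in> I" using Suc by auto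
  ultimately show ?case using I by (simp add: right_ideals_def)
qed

end

section \<open>Coordinates with respect to a basis\<close>

locale frobenius_field_basis = frobenius_field q n ty
  for q n and ty :: "'a::{field,finite} itself" +
  fixes \<beta> :: "nat \<Rightarrow> 'a"
  assumes basis: "is_basis q n \<beta>"
begin

definition is_coord :: "'a \<Rightarrow> (nat \<Rightarrow> 'a) \<Rightarrow> bool" where
  "is_coord x c \<longleftrightarrow> (\<forall>i<n. c i \<in> subF q) \<and> (\<forall>i. n \<le> i \<longrightarrow> c i = 0) \<and> x = (\<Sum>i<n. c i * \<beta> i)"

lemma ex1_coord: "\<exists>!c. is_coord x c"
  using basis by (simp add: is_basis_def is_coord_def)

definition coord :: "'a \<Rightarrow> nat \<Rightarrow> 'a" where
  "coord x = (THE c. is_coord x c)"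

lemma is_coord_coord: "is_coord x (coord x)"
  unfolding coord_def by (rule theI'[OF ex1_coord])

lemma coord_subF [simp, intro]: "i < n \<Longrightarrow> coord x i \<in> subF q"
  and coord_sum: "(\<Sum>i<n. coord x i * \<beta> i) = x"
  using is_coord_coord[of x] by (simp_all add: is_coord_def)

lemma coord_eqI:
  assumes "\<And>i. i < n \<Longrightarrow> c i \<in> subF q" "x = (\<Sum>i<n. c i * \<beta> i)" "i < n"
  shows "coord x i = c i"
proof -
  have "is_coord x (\<lambda>i. if i < n then c i else 0)"
    unfolding is_coord_def using assms(1,2) by simp
  then have "coord x = (\<lambda>i. if i < n then c i else 0)"
    using ex1_coord is_coord_coord by blast
  then show ?thesis using assms(3) by simp
qed

lemma coord_linear:
  assumes "\<And>l. l \<in> L \<Longrightarrow> k l \<in> subF q" "i < n"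
  shows "coord (\<Sum>l\<in>L. k l * x l) i = (\<Sum>l\<in>L. k l * coord (x l) i)"
proof (rule coord_eqI)
  have "(\<Sum>l\<in>L. k l * x l) = (\<Sum>l\<in>L. k l * (\<Sum>i<n. coord (x l) i * \<beta> i))"
    by (simp add: coord_sum)
  also have "\<dots> = (\<Sum>l\<in>L. \<Sum>i<n. k l * coord (x l) i * \<beta> i)"
    by (simp add: sum_distrib_left mult.assoc)
  also have "\<dots> = (\<Sum>i<n. \<Sum>l\<in>L. k l * coord (x l) i * \<beta> i)" by (rule sum.swap)
  finally show "(\<Sum>l\<in>L. k l * x l) = (\<Sum>i<n. (\<Sum>l\<in>L. k l * coord (x l) i) * \<beta> i)"
    by (simp add: sum_distrib_right)
qed (use assms in auto)

text \<open>Splits a matrix over the large field into \<open>n\<close> matrices over the subfield: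
  \<open>X\<close> is the sum of the \<open>mcoord k X\<close> scaled by
  \<open>\<beta> k\<close>.\<close>

definition mcoord :: "nat \<Rightarrow> 'a mat \<Rightarrow> 'a mat" where
  "mcoord k X = map_mat (\<lambda>x. coord x k) X"

lemma mcoord_M [simp, intro]: "X \<in> M \<Longrightarrow> mcoord k X \<in> M"
  by (simp add: mcoord_def)

lemma mcoord_KM [simp, intro]: "\<lbrakk>X \<in> M; k < n\<rbrakk> \<Longrightarrow> mcoord k X \<in> KM"
  by (auto simp: KM_def mcoord_def)

text \<open>Coordinates are linear over the subfield, where \<open>A\<close> has its entries. With
  the analogue for right factors this splits \<open>X * A = B * X\<close> into \<open>n\<close>
  equations over the subfield.\<close>

lemma mcoord_mult_left:
  assumes "A \<in> KM" "X \<in> M" "k < n"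
  shows "mcoord k (A * X) = A * mcoord k X"
proof (rule eq_matI)
  fix i j assume "i < dim_row (A * mcoord k X)" "j < dim_col (A * mcoord k X)"
  then show "mcoord k (A * X) $$ (i, j) = (A * mcoord k X) $$ (i, j)"
    using assms by (auto simp: mcoord_def KM_def scalar_prod_def intro!: coord_linear)
qed (use assms in \<open>auto simp: mcoord_def KM_def\<close>)

lemma mcoord_mult_right:
  assumes "A \<in> KM" "X \<in> M" "k < n"
  shows "mcoord k (X * A) = mcoord k X * A"
proof (rule eq_matI)
  fix i j assume "i < dim_row (mcoord k X * A)" "j < dim_col (mcoord k X * A)"
  then show "mcoord k (X * A) $$ (i, j) = (mcoord k X * A) $$ (i, j)"
    using assms by (auto simp: mcoord_def KM_def scalar_prod_def mult.commute[of _ "A $$ _"] intro!: coord_linear)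
qed (use assms in \<open>auto simp: mcoord_def KM_def\<close>)

lemma mcoord_eqI:
  assumes "X \<in> M" "Y \<in> M" "\<And>k. k < n \<Longrightarrow> mcoord k X = mcoord k Y"
  shows "X = Y"
proof (rule eq_matI)
  fix i j assume ij: "i < dim_row Y" "j < dim_col Y"
  have "coord (X $$ (i, j)) k = coord (Y $$ (i, j)) k" if "k < n" for k
    using arg_cong[OF assms(3)[OF that], of "\<lambda>Z. Z $$ (i, j)"] ij assms(1,2)
    by (auto simp: mcoord_def)
  then have "(\<Sum>k<n. coord (X $$ (i, j)) k * \<beta> k) = (\<Sum>k<n. coord (Y $$ (i, j)) k * \<beta> k)"
    by (intro sum.cong) auto
  then show "X $$ (i, j) = Y $$ (i, j)" by (simp only: coord_sum)
qed (use assms in auto)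

lemma mcoord_surj:
  assumes "\<And>k. k < n \<Longrightarrow> Z k \<in> KM"
  obtains X where "X \<in> M" "\<And>k. k < n \<Longrightarrow> mcoord k X = Z k"
proof
  let ?X = "mat n n (\<lambda>ij. \<Sum>k<n. Z k $$ ij * \<beta> k)"
  show "mcoord k ?X = Z k" if k: "k < n" for k
  proof (rule eq_matI)
    fix i j assume "i < dim_row (Z k)" "j < dim_col (Z k)"
    then have ij: "i < n" "j < n" using assms[OF k] by (auto simp: KM_def)
    then show "mcoord k ?X $$ (i, j) = Z k $$ (i, j)"
      using assms k by (auto simp: mcoord_def KM_def intro!: coord_eqI)
  qed (use assms[OF k] in \<open>auto simp: mcoord_def KM_def\<close>)
qed simp

section \<open>Extension of scalars and descent\<close>

text \<open>For a right ideal \<open>I\<close> this is its span over the large field.\<close>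

definition extension :: "'a mat set \<Rightarrow> 'a mat set" where
  "extension I = {X \<in> M. \<forall>k<n. mcoord k X \<in> I}"

text \<open>The extended ideal must absorb matrices over the large field, because the conjugating
  matrices of \<open>conj_descent\<close> live there.\<close>

lemma extension_mult:
  assumes I: "I \<in> right_ideals" and X: "X \<in> extension I" and T: "T \<in> M"
  shows "X * T \<in> extension I"
proof -
  have XM: "X \<in> M" and XI: "\<And>k. k < n \<Longrightarrow> mcoord k X \<in> I" using X by (auto simp: extension_def)
  have "mcoord k (X * T) \<in> I" if k: "k < n" for k
  proof -
    \<comment> \<open>Expand \<open>X\<close> along the basis: the entries of
      \<open>mcoord l X\<close> lie in the subfield and can be pulled out of \<open>coord\<close>,
      while \<open>\<beta> l\<close> is absorbed into \<open>T\<close>.\<close>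
    define Z where "Z l = mcoord l X * mcoord k (\<beta> l \<cdot>\<^sub>m T)" for l
    have "mcoord k (X * T) = mat n n (\<lambda>ij. \<Sum>l<n. Z l $$ ij)"
    proof (rule eq_matI)
      fix i j assume "i < dim_row (mat n n (\<lambda>ij. \<Sum>l<n. Z l $$ ij))"
        "j < dim_col (mat n n (\<lambda>ij. \<Sum>l<n. Z l $$ ij))"
      then have ij: "i < n" "j < n" by auto
      have "mcoord k (X * T) $$ (i, j) = coord (\<Sum>m<n. X $$ (i, m) * T $$ (m, j)) k"
        using ij XM T by (simp add: mcoord_def scalar_prod_def lessThan_atLeast0)
      also have "(\<Sum>m<n. X $$ (i, m) * T $$ (m, j))
          = (\<Sum>m<n. (\<Sum>l<n. coord (X $$ (i, m)) l * \<beta> l) * T $$ (m, j))"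
        by (simp add: coord_sum)
      also have "\<dots> = (\<Sum>(m, l)\<in>{..<n} \<times> {..<n}. coord (X $$ (i, m)) l * (\<beta> l * T $$ (m, j)))"
        by (simp add: sum_distrib_right sum.cartesian_product mult.assoc)
      also have "coord \<dots> k = (\<Sum>(m, l)\<in>{..<n} \<times> {..<n}. coord (X $$ (i, m)) l * coord (\<beta> l * T $$ (m, j)) k)"
        unfolding case_prod_beta using k by (intro coord_linear) auto
      also have "\<dots> = (\<Sum>l<n. \<Sum>m<n. coord (X $$ (i, m)) l * coord (\<beta> l * T $$ (m, j)) k)"
        unfolding sum.cartesian_product[symmetric] by (rule sum.swap)
      also have "\<dots> = (\<Sum>l<n. Z l $$ (i, j))"
        using ij XM T by (intro sum.cong refl) (simp add: Z_def mcoord_def scalar_prod_def lessThan_atLeast0)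
      finally show "mcoord k (X * T) $$ (i, j) = mat n n (\<lambda>ij. \<Sum>l<n. Z l $$ ij) $$ (i, j)"
        using ij by simp
    qed (use XM T in \<open>auto simp: mcoord_def\<close>)
    moreover have "Z l \<in> I" if "l < n" for l
      using XI[OF that] I T k by (auto simp: Z_def right_ideals_def)
    ultimately show ?thesis by (simp add: right_ideal_sum[OF I])
  qed
  then show ?thesis using XM T by (simp add: extension_def)
qed

text \<open>A solution over the large field is the same as \<open>n\<close> independently chosen
  solutions over the subfield, its coordinate matrices.\<close>

lemma card_extension:
  assumes A: "A \<in> KM" and B: "B \<in> KM"
  shows "card {X \<in> extension I. X * A = B * X} = card {X \<in> intertwiners A B. X \<in> I} ^ n"
proof -
  let ?F = "\<lambda>X. \<lambda>k\<in>{..<n}. mcoord k X"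
  let ?H = "{X \<in> intertwiners A B. X \<in> I}"
  have AB: "A \<in> M" "B \<in> M" using A B KM_M by auto
  have comm: "X * A = B * X \<longleftrightarrow> (\<forall>k<n. mcoord k X * A = B * mcoord k X)" if "X \<in> M" for X
  proof
    assume "X * A = B * X"
    then show "\<forall>k<n. mcoord k X * A = B * mcoord k X"
      using that A B mcoord_mult_left mcoord_mult_right by metis
  next
    assume *: "\<forall>k<n. mcoord k X * A = B * mcoord k X"
    show "X * A = B * X"
      by (rule mcoord_eqI) (use that A B AB * in \<open>auto simp: mcoord_mult_left mcoord_mult_right\<close>)
  qed
  have "bij_betw ?F {X \<in> extension I. X * A = B * X} ({..<n} \<rightarrow>\<^sub>E ?H)"
    unfolding bij_betw_def
  proof
    show "inj_on ?F {X \<in> extension I. X * A = B * X}"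
    proof (rule inj_onI)
      fix X Y assume "X \<in> {X \<in> extension I. X * A = B * X}" "Y \<in> {X \<in> extension I. X * A = B * X}"
        and eq: "?F X = ?F Y"
      moreover have "mcoord k X = mcoord k Y" if "k < n" for k
        using fun_cong[OF eq, of k] that by simp
      moreover have "X \<in> M" "Y \<in> M" using calculation(1,2) unfolding extension_def by blast+
      ultimately show "X = Y" using mcoord_eqI by blast
    qed
    show "?F ` {X \<in> extension I. X * A = B * X} = ({..<n} \<rightarrow>\<^sub>E ?H)"
    proof
      show "?F ` {X \<in> extension I. X * A = B * X} \<subseteq> ({..<n} \<rightarrow>\<^sub>E ?H)"
        using comm by (auto simp: extension_def intertwiners_def)
      show "({..<n} \<rightarrow>\<^sub>E ?H) \<subseteq> ?F ` {X \<in> extension I. X * A = B * X}"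
      proof
        fix Z assume Z: "Z \<in> {..<n} \<rightarrow>\<^sub>E ?H"
        then have ZH: "\<And>k. k < n \<Longrightarrow> Z k \<in> ?H" by auto
        then obtain X where X: "X \<in> M" "\<And>k. k < n \<Longrightarrow> mcoord k X = Z k"
          using mcoord_surj[of Z] by (auto simp: intertwiners_def)
        have "X \<in> {X \<in> extension I. X * A = B * X}"
          using X ZH comm[OF X(1)] by (auto simp: extension_def intertwiners_def)
        moreover have "Z = ?F X" using X Z by (auto simp: PiE_def extensional_def)
        ultimately show "Z \<in> ?F ` {X \<in> extension I. X * A = B * X}" by blast
      qed
    qed
  qed
  then have "card {X \<in> extension I. X * A = B * X} = card ({..<n} \<rightarrow>\<^sub>E ?H)"
    by (rule bij_betw_same_card)
  then show ?thesis by (simp add: card_PiE)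
qed

text \<open>Cancellation by counting: the numbers of intertwiners into an ideal determine, by inclusion
  over the generated ideals, the number of invertible ones.\<close>
lemma conj_descent:
  assumes A: "A \<in> KM" and B: "B \<in> KM"
    and S: "S \<in> M" "T \<in> M" "S * T = 1\<^sub>m n" "T * S = 1\<^sub>m n" "B = S * A * T"
  obtains X Y where "X \<in> KM" "Y \<in> KM" "X * Y = 1\<^sub>m n" "Y * X = 1\<^sub>m n" "B = X * A * Y"
proof -
  have AM: "A \<in> M" "B \<in> M" using A B KM_M by auto
  note [simp] = M_assoc M_cancel[OF _ _ _ S(3)] M_cancel[OF _ _ _ S(4)]
  have TB: "T * B = A * T" "B * S = S * A" using S AM by simp_all
  \<comment> \<open>Over the large field, right multiplication by \<open>T\<close> turns solutions
    for the pair \<open>A\<close>, \<open>B\<close> into solutions for the pair \<open>B\<close>,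
    \<open>B\<close>, and \<open>S\<close> reverts this.\<close>
  have cardE: "card {X \<in> extension I. X * A = B * X} = card {X \<in> extension I. X * B = B * X}"
    if I: "I \<in> right_ideals" for I
  proof (rule bij_betw_same_card)
    show "bij_betw (\<lambda>X. X * T) {X \<in> extension I. X * A = B * X} {X \<in> extension I. X * B = B * X}"
    proof (rule bij_betw_byWitness[where f' = "\<lambda>X. X * S"])
      have m: "X \<in> M" if "X \<in> extension I" for X using that by (simp add: extension_def)
      show "\<forall>X\<in>{X \<in> extension I. X * A = B * X}. X * T * S = X" using m S by simp
      show "\<forall>X\<in>{X \<in> extension I. X * B = B * X}. X * S * T = X" using m S by simp
      have "X * T * B = B * (X * T)" if "X \<in> M" "X * A = B * X" for X
      proof -
        have "X * T * B = X * (T * B)" using that(1) S(2) AM by simp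
        also have "\<dots> = (X * A) * T" unfolding TB using that(1) S(2) AM by simp
        also have "\<dots> = B * (X * T)" unfolding that(2) using that(1) S(2) AM by simp
        finally show ?thesis .
      qed
      then show "(\<lambda>X. X * T) ` {X \<in> extension I. X * A = B * X} \<subseteq> {X \<in> extension I. X * B = B * X}"
        using m extension_mult[OF I _ S(2)] by blast
      have "X * S * A = B * (X * S)" if "X \<in> M" "X * B = B * X" for X
      proof -
        have "X * S * A = X * (S * A)" using that(1) S(1) AM by simp
        also have "\<dots> = (X * B) * S" unfolding TB(2)[symmetric] using that(1) S(1) AM by simp
        also have "\<dots> = B * (X * S)" unfolding that(2) using that(1) S(1) AM by simp
        finally show ?thesis .
      qed
      then show "(\<lambda>X. X * S) ` {X \<in> extension I. X * B = B * X} \<subseteq> {X \<in> extension I. X * A = B * X}"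
        using m extension_mult[OF I _ S(1)] by blast
    qed
  qed
  have "card {X \<in> intertwiners A B. X \<in> I} = card {X \<in> intertwiners B B. X \<in> I}"
    if I: "I \<in> right_ideals" for I
  proof -
    have "card {X \<in> intertwiners A B. X \<in> I} ^ n = card {X \<in> intertwiners B B. X \<in> I} ^ n"
      using cardE[OF I] card_extension[OF A B] card_extension[OF B B] by simp
    then show ?thesis using n_pos by (simp add: power_eq_iff_eq_base)
  qed
  moreover have KI: "gen (1\<^sub>m n) \<in> right_ideals" using gen_right_ideal KM_one by blast
  ultimately have "card {X \<in> intertwiners A B. gen X = gen (1\<^sub>m n)}
      = card {X \<in> intertwiners B B. gen X = gen (1\<^sub>m n)}" by (rule card_generators_eq)
  \<comment> \<open>For the pair \<open>B\<close>, \<open>B\<close> the identity is an intertwiner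
    generating the whole ring, so the common count is positive.\<close>
  moreover have "1\<^sub>m n \<in> {X \<in> intertwiners B B. gen X = gen (1\<^sub>m n)}"
    using KM_one AM by (simp add: intertwiners_def)
  moreover have "finite {X \<in> intertwiners B B. gen X = gen (1\<^sub>m n)}"
    using finite_KM by (rule rev_finite_subset) (auto simp: intertwiners_def)
  ultimately have "{X \<in> intertwiners A B. gen X = gen (1\<^sub>m n)} \<noteq> {}"
    by (metis card_eq_0_iff empty_iff)
  then obtain X where X: "X \<in> KM" "X * A = B * X" "gen X = gen (1\<^sub>m n)"
    by (auto simp: intertwiners_def)
  \<comment> \<open>Generating the whole ring means having a right inverse over the subfield, which
    for square matrices is two-sided.\<close>
  have "1\<^sub>m n \<in> gen X" using gen_self[OF KM_one] X(3) by simp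
  then obtain Y where Y: "Y \<in> KM" "X * Y = 1\<^sub>m n" by (auto simp: gen_def)
  have XY: "X \<in> M" "Y \<in> M" using X Y KM_M by auto
  have YX: "Y * X = 1\<^sub>m n" using mat_mult_left_right_inverse[OF XY Y(2)] .
  have "X * A * Y = B" unfolding X(2) using XY AM Y(2) by simp
  then show ?thesis using that X Y YX by metis
qed

end

section \<open>Coefficient matrices and Moore matrices\<close>

text \<open>Multiplication by a nonzero \<open>x\<close> permutes the nonzero elements; comparing
  products gives the claim.\<close>

lemma power_card_field: "(x :: 'a :: {field,finite}) ^ card (UNIV :: 'a set) = x"
proof (cases "x = 0")
  case False
  let ?U = "UNIV - {0 :: 'a}"
  have "bij_betw ((*) x) ?U ?U"
    by (rule bij_betw_byWitness[where f' = "\<lambda>y. y / x"]) (use False in auto)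
  then have "(\<Prod>y\<in>?U. x * y) = \<Prod>?U" by (rule prod.reindex_bij_betw)
  moreover have "\<Prod>?U \<noteq> 0" by simp
  ultimately have "x ^ card ?U = 1" by (simp add: prod.distrib)
  moreover have "card (UNIV :: 'a set) = Suc (card ?U)"
    by (rule card.remove) auto
  ultimately show ?thesis by (simp only: power_Suc mult_1_right)
qed (simp add: finite_UNIV_card_ge_0)

text \<open>Translation by one permutes the field; comparing sums shows that the order of the field
  vanishes in it.\<close>

lemma CHAR_dvd_card_field: "CHAR('a :: {field,finite}) dvd card (UNIV :: 'a set)"
proof -
  have "bij_betw (\<lambda>x. x + 1) (UNIV :: 'a set) UNIV"
    by (rule bij_betw_byWitness[where f' = "\<lambda>x. x - 1"]) auto
  then have "(\<Sum>x\<in>UNIV. x + 1) = (\<Sum>x\<in>UNIV. x :: 'a)"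
    by (rule sum.reindex_bij_betw)
  then have "of_nat (card (UNIV :: 'a set)) = (0 :: 'a)" by (simp add: sum.distrib)
  then show ?thesis using of_nat_eq_0_iff_char_dvd by blast
qed

section \<open>Inverses and conjugacy of matrices\<close>

text \<open>\<open>mat_inv\<close> is a definite description, so uniqueness of the inverse is shown
  before its properties are read off.\<close>

lemma mat_inv:
  assumes A: "(A :: 'a :: field mat) \<in> carrier_mat n n" and det: "det A \<noteq> 0"
  shows "mat_inv A \<in> carrier_mat n n" "A * mat_inv A = 1\<^sub>m n" "mat_inv A * A = 1\<^sub>m n"
proof -
  have "A \<in> Units (ring_mat TYPE('a) n ())" using det_non_zero_imp_unit[OF assms] .
  then obtain B where B: "B \<in> carrier_mat n n" "A * B = 1\<^sub>m n" "B * A = 1\<^sub>m n"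
    by (auto simp: Units_def ring_mat_def)
  let ?P = "\<lambda>B. B \<in> carrier_mat (dim_row A) (dim_row A) \<and> A * B = 1\<^sub>m (dim_row A) \<and> B * A = 1\<^sub>m (dim_row A)"
  have "C = B" if "?P C" for C
  proof -
    have "C \<in> carrier_mat n n" "C * A = 1\<^sub>m n" using that A by auto
    then have "C * A * B = B" "C * (A * B) = C" "C * A * B = C * (A * B)"
      using A B assoc_mult_mat[of C n n A n B n] by auto
    then show ?thesis by simp
  qed
  moreover have "?P B" using A B by auto
  ultimately have "\<exists>!B. ?P B" by blast
  then have "?P (THE B. ?P B)" by (rule theI')
  then show "mat_inv A \<in> carrier_mat n n" "A * mat_inv A = 1\<^sub>m n" "mat_inv A * A = 1\<^sub>m n"
    using A by (auto simp: mat_inv_def)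
qed

lemma conj_GL_UNIV_trans:
  assumes "A \<in> carrier_mat n n" "conj_GL UNIV n A B" "conj_GL UNIV n B C"
  shows "conj_GL UNIV n A C"
proof -
  obtain S T where S: "S \<in> carrier_mat n n" "T \<in> carrier_mat n n" "S * T = 1\<^sub>m n" "T * S = 1\<^sub>m n"
    "B = S * A * T"
    using assms(2) unfolding conj_GL_def by blast
  obtain S' T' where S': "S' \<in> carrier_mat n n" "T' \<in> carrier_mat n n" "S' * T' = 1\<^sub>m n" "T' * S' = 1\<^sub>m n"
    "C = S' * B * T'"
    using assms(3) unfolding conj_GL_def by blast
  note [simp] = assoc_mult_mat[of _ n n _ n _ n]
  have c: "S * (T * X) = X" "T' * (S' * X) = X" "T * (S * X) = X" "S' * (T' * X) = X"
    if "X \<in> carrier_mat n n" for X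
    using that S S' by (simp_all flip: assoc_mult_mat[of _ n n _ n _ n])
  have *: "(S' * S) * (T * T') = 1\<^sub>m n" "(T * T') * (S' * S) = 1\<^sub>m n"
    "C = (S' * S) * A * (T * T')"
    using S S' assms(1) c by simp_all
  have "S' * S \<in> carrier_mat n n" "T * T' \<in> carrier_mat n n" using S S' by auto
  with * show ?thesis unfolding conj_GL_def by blast
qed

lemma conj_GL_UNIV_sym:
  assumes "A \<in> carrier_mat n n" "conj_GL UNIV n A B"
  shows "conj_GL UNIV n B A"
proof -
  obtain S T where S: "S \<in> carrier_mat n n" "T \<in> carrier_mat n n" "S * T = 1\<^sub>m n" "T * S = 1\<^sub>m n"
    "B = S * A * T"
    using assms(2) unfolding conj_GL_def by blast
  note [simp] = assoc_mult_mat[of _ n n _ n _ n]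
  have c: "T * (S * X) = X" if "X \<in> carrier_mat n n" for X
    using that S by (simp flip: assoc_mult_mat[of _ n n _ n _ n])
  have "A = T * B * S" using S assms(1) c by simp
  then show ?thesis using S unfolding conj_GL_def by blast
qed

context frobenius_field begin

section \<open>Iterated Frobenius, trace and sesquilinearity\<close>

lemma frob_iter: "((x::'a) + y) ^ (q ^ k) = x ^ (q ^ k) + y ^ (q ^ k)"
  by (induction k) (simp_all add: power_mult frob_add mult.commute[of q])

lemma frob_iter_sum: "(\<Sum>i\<in>I. f i :: 'a) ^ (q ^ k) = (\<Sum>i\<in>I. f i ^ (q ^ k))"
  by (induction I rule: infinite_finite_induct) (use q_pos in \<open>simp_all add: frob_iter power_0_left\<close>)

lemma frob_card: "(x::'a) ^ (q ^ (2 * n)) = x"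
  using power_card_field[of x] by (simp add: card_field)

lemma frob_mod: "(x::'a) ^ (q ^ (2 * (m mod n))) = x ^ (q ^ (2 * m))"
proof -
  have "x ^ (q ^ (2 * (r + t * n))) = x ^ (q ^ (2 * r))" for r t
  proof (induction t)
    case (Suc t)
    have "2 * (r + Suc t * n) = 2 * n + 2 * (r + t * n)" by simp
    then show ?case using Suc frob_card by (simp add: power_add power_mult)
  qed simp
  from this[of "m mod n" "m div n"] show ?thesis by simp
qed

lemma subF_iter: "(c::'a) \<in> subF q \<Longrightarrow> c ^ (q ^ (2 * k)) = c"
proof (induction k)
  case (Suc k)
  have e: "q ^ (2 * Suc k) = q ^ 2 * q ^ (2 * k)" by (simp add: power_add[symmetric])
  have "c ^ q ^ (2 * Suc k) = (c ^ q ^ 2) ^ q ^ (2 * k)" unfolding e by (rule power_mult)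
  also have "\<dots> = c" using Suc by (simp add: subF_def)
  finally show ?case .
qed simp

text \<open>The power \<open>q^2\<close> shifts the conjugates by one, and the last wraps around to
  the first by \<open>frob_card\<close>.\<close>

lemma Tr_subF: "(Tr q n (x::'a)) \<in> subF q"
proof -
  have "Tr q n x ^ q ^ 2 = (\<Sum>i<n. x ^ (q ^ (2 * Suc i)))"
    unfolding Tr_def frob_iter_sum by (simp add: power_mult[symmetric] power_add[symmetric])
  also have "\<dots> = (\<Sum>i<n. x ^ (q ^ (2 * i)))"
    using sum.lessThan_Suc_shift[of "\<lambda>i. x ^ (q ^ (2 * i))" n]
      sum.lessThan_Suc[of "\<lambda>i. x ^ (q ^ (2 * i))" n] frob_card[of x] by simp
  finally show ?thesis by (simp add: subF_def Tr_def)
qed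

lemma sform_sum_left:
  assumes "\<And>i. i \<in> I \<Longrightarrow> c i \<in> subF q"
  shows "sform q n a (\<Sum>i\<in>I. c i * x i) (v::'a) = (\<Sum>i\<in>I. c i * sform q n a (x i) v)"
proof -
  have "sform q n a (\<Sum>i\<in>I. c i * x i) v
      = (\<Sum>k<n. \<Sum>i\<in>I. c i * (x i * linpoly q n a (v ^ q)) ^ (q ^ (2 * k)))"
    unfolding sform_def Tr_def sum_distrib_right frob_iter_sum
    using assms by (intro sum.cong refl) (simp add: power_mult_distrib subF_iter mult.assoc)
  also have "\<dots> = (\<Sum>i\<in>I. c i * sform q n a (x i) v)"
    unfolding sform_def Tr_def sum_distrib_left by (rule sum.swap)
  finally show ?thesis .
qed

text \<open>Coefficients enter through \<open>v ^ q\<close>, which gives them the exponent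
  \<open>q\<close>. All later powers are iterates of the \<open>q^2\<close>-power map, which fix the
  subfield.\<close>

lemma sform_sum_right:
  assumes "\<And>i. i \<in> I \<Longrightarrow> c i \<in> subF q"
  shows "sform q n a u (\<Sum>i\<in>I. c i * x i :: 'a) = (\<Sum>i\<in>I. c i ^ q * sform q n a u (x i))"
proof -
  have v: "(\<Sum>i\<in>I. c i * x i) ^ q = (\<Sum>i\<in>I. c i ^ q * x i ^ q)"
    using frob_iter_sum[of "\<lambda>i. c i * x i" I 1] by (simp add: power_mult_distrib)
  have "linpoly q n a ((\<Sum>i\<in>I. c i * x i) ^ q) = (\<Sum>k<n. \<Sum>i\<in>I. c i ^ q * (a k * (x i ^ q) ^ (q ^ (2 * k))))"
    unfolding linpoly_def v frob_iter_sum sum_distrib_left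
    using assms by (intro sum.cong refl) (simp add: power_mult_distrib subF_iter)
  also have "\<dots> = (\<Sum>i\<in>I. c i ^ q * linpoly q n a (x i ^ q))"
    unfolding linpoly_def sum_distrib_left by (rule sum.swap)
  finally have L: "u * linpoly q n a ((\<Sum>i\<in>I. c i * x i) ^ q)
      = (\<Sum>i\<in>I. c i ^ q * (u * linpoly q n a (x i ^ q)))"
    by (simp add: sum_distrib_left mult.left_commute)
  have "sform q n a u (\<Sum>i\<in>I. c i * x i)
      = (\<Sum>k<n. \<Sum>i\<in>I. c i ^ q * (u * linpoly q n a (x i ^ q)) ^ (q ^ (2 * k)))"
    unfolding sform_def Tr_def L frob_iter_sum
    using assms by (intro sum.cong refl) (simp add: power_mult_distrib subF_iter)
  also have "\<dots> = (\<Sum>i\<in>I. c i ^ q * sform q n a u (x i))"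
    unfolding sform_def Tr_def sum_distrib_left by (rule sum.swap)
  finally show ?thesis .
qed

lemma sform_sum_sum:
  assumes "\<And>i. i < m \<Longrightarrow> c i \<in> subF q" "\<And>j. j < m \<Longrightarrow> d j \<in> subF q"
  shows "sform q n a (\<Sum>i<m. c i * x i) (\<Sum>j<m. d j * y j :: 'a)
    = (\<Sum>i<m. c i * (\<Sum>j<m. d j ^ q * sform q n a (x i) (y j)))"
proof -
  have "sform q n a (\<Sum>i<m. c i * x i) (\<Sum>j<m. d j * y j)
      = (\<Sum>i<m. c i * sform q n a (x i) (\<Sum>j<m. d j * y j))"
    by (rule sform_sum_left) (use assms in auto)
  moreover have "sform q n a (x i) (\<Sum>j<m. d j * y j) = (\<Sum>j<m. d j ^ q * sform q n a (x i) (y j))" for i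
    by (rule sform_sum_right) (use assms in auto)
  ultimately show ?thesis by simp
qed

lemma coeff_mat_M [simp, intro]: "coeff_mat n \<sigma> (x :: nat \<Rightarrow> 'a) \<in> M"
  by (simp add: coeff_mat_def)

lemma coeff_mat_KM: "coeff_mat n (sform q n a) (x :: nat \<Rightarrow> 'a) \<in> KM"
  by (auto simp: KM_def coeff_mat_def sform_def Tr_subF)

lemma index_congruence:
  assumes "(S :: 'a mat) \<in> M" "C \<in> M" "i < n" "j < n"
  shows "(S * C * star_mat q S) $$ (i, j) = (\<Sum>l<n. \<Sum>k<n. S $$ (i, k) * S $$ (j, l) ^ q * C $$ (k, l))"
proof -
  have "(S * C * star_mat q S) $$ (i, j) = (\<Sum>l<n. (\<Sum>k<n. S $$ (i, k) * C $$ (k, l)) * S $$ (j, l) ^ q)"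
    using assms by (simp add: scalar_prod_def star_mat_def lessThan_atLeast0)
  then show ?thesis by (simp only: sum_distrib_right) (simp add: mult_ac)
qed

lemma coeff_mat_change:
  assumes S: "S \<in> KM" and x: "\<And>i. i < n \<Longrightarrow> x i = (\<Sum>k<n. S $$ (i, k) * y k)"
  shows "coeff_mat n (sform q n a) x = S * coeff_mat n (sform q n a) y * star_mat q S"
proof (rule eq_matI)
  have SM: "S \<in> M" using S KM_M by blast
  fix i j assume "i < dim_row (S * coeff_mat n (sform q n a) y * star_mat q S)"
    "j < dim_col (S * coeff_mat n (sform q n a) y * star_mat q S)"
  then have ij: "i < n" "j < n" using SM by (auto simp: star_mat_def)
  have "coeff_mat n (sform q n a) x $$ (i, j)
      = sform q n a (\<Sum>k<n. S $$ (i, k) * y k) (\<Sum>l<n. S $$ (j, l) * y l)"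
    using ij x by (simp add: coeff_mat_def)
  also have "\<dots> = (\<Sum>k<n. S $$ (i, k) * (\<Sum>l<n. S $$ (j, l) ^ q * sform q n a (y k) (y l)))"
    using S ij by (intro sform_sum_sum) (auto simp: KM_def)
  also have "\<dots> = (\<Sum>l<n. \<Sum>k<n. S $$ (i, k) * S $$ (j, l) ^ q * sform q n a (y k) (y l))"
    by (subst sum.swap) (simp add: sum_distrib_left mult.assoc)
  also have "\<dots> = (S * coeff_mat n (sform q n a) y * star_mat q S) $$ (i, j)"
    using index_congruence[OF SM _ ij, of "coeff_mat n (sform q n a) y"] by (simp add: coeff_mat_def)
  finally show "coeff_mat n (sform q n a) x $$ (i, j)
      = (S * coeff_mat n (sform q n a) y * star_mat q S) $$ (i, j)" .
qed (use S in \<open>auto simp: KM_def star_mat_def coeff_mat_def\<close>)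

section \<open>Moore matrices\<close>

text \<open>The Moore matrix: row \<open>i\<close> lists the conjugates of \<open>x i\<close> over
  the subfield.\<close>

definition moore :: "(nat \<Rightarrow> 'a) \<Rightarrow> 'a mat" where
  "moore x = mat n n (\<lambda>(i, j). x i ^ (q ^ (2 * j)))"

lemma moore_M [simp, intro]: "moore x \<in> M" and M_L_M [simp, intro]: "M_L q n (a :: nat \<Rightarrow> 'a) \<in> M"
  and P_mat_M [simp, intro]: "(P_mat n :: 'a mat) \<in> M"
  by (simp_all add: moore_def M_L_def P_mat_def)

text \<open>The trace is a sum over conjugates. The \<open>k\<close>-th conjugate of the value of
  the polynomial at \<open>x j ^ q\<close> is a combination of the conjugates of
  \<open>x j ^ q\<close>, and its coefficients form row \<open>k\<close> of
  \<open>M_L\<close>.\<close>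

lemma coeff_mat_eq_moore:
  "coeff_mat n (sform q n a) x = moore x * M_L q n a * star_mat q (moore x)"
proof (rule eq_matI)
  fix i j assume "i < dim_row (moore x * M_L q n a * star_mat q (moore x))"
    "j < dim_col (moore x * M_L q n a * star_mat q (moore x))"
  then have ij: "i < n" "j < n" by (auto simp: moore_def star_mat_def)
  have "linpoly q n a (x j ^ q) ^ (q ^ (2 * k))
      = (\<Sum>l<n. (x j ^ q ^ (2 * l)) ^ q * a ((l + n - k) mod n) ^ (q ^ (2 * k)))" if k: "k < n" for k
  proof -
    \<comment> \<open>The substitution \<open>l = (m + k) mod n\<close> read backwards; the summand
      \<open>n\<close> prevents truncated subtraction.\<close>
    have bij: "bij_betw (\<lambda>l. (l + n - k) mod n) {..<n} {..<n}"
    proof (rule bij_betw_byWitness[where f' = "\<lambda>m. (m + k) mod n"])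
      show "\<forall>l\<in>{..<n}. ((l + n - k) mod n + k) mod n = l"
        using k by (auto simp: mod_add_left_eq)
      show "\<forall>m\<in>{..<n}. ((m + k) mod n + n - k) mod n = m"
      proof
        fix m assume m: "m \<in> {..<n}"
        show "((m + k) mod n + n - k) mod n = m"
        proof (cases "m + k < n")
          case False
          then have "(m + k) mod n = m + k - n" using m k by (simp add: mod_if)
          then show ?thesis using m k False by simp
        qed (use m in simp)
      qed
    qed (use n_pos in auto)
    have "linpoly q n a (x j ^ q) ^ (q ^ (2 * k))
        = (\<Sum>m<n. a m ^ (q ^ (2 * k)) * (x j ^ q) ^ (q ^ (2 * (m + k))))"
      unfolding linpoly_def frob_iter_sum
      by (intro sum.cong refl) (simp add: power_mult_distrib power_mult[symmetric] power_add distrib_left mult.assoc)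
    also have "\<dots> = (\<Sum>l<n. a ((l + n - k) mod n) ^ (q ^ (2 * k)) * (x j ^ q) ^ (q ^ (2 * ((l + n - k) mod n + k))))"
      by (rule sum.reindex_bij_betw[OF bij, symmetric])
    also have "\<dots> = (\<Sum>l<n. (x j ^ q ^ (2 * l)) ^ q * a ((l + n - k) mod n) ^ (q ^ (2 * k)))"
    proof (intro sum.cong refl)
      fix l assume l: "l \<in> {..<n}"
      have "((l + n - k) mod n + k) mod n = l" using l k by (auto simp: mod_add_left_eq)
      then have "(x j ^ q) ^ (q ^ (2 * ((l + n - k) mod n + k))) = (x j ^ q) ^ (q ^ (2 * l))"
        using frob_mod[of "x j ^ q" "(l + n - k) mod n + k"] by simp
      then show "a ((l + n - k) mod n) ^ (q ^ (2 * k)) * (x j ^ q) ^ (q ^ (2 * ((l + n - k) mod n + k)))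
          = (x j ^ q ^ (2 * l)) ^ q * a ((l + n - k) mod n) ^ (q ^ (2 * k))"
        by (simp add: power_mult[symmetric] mult.commute)
    qed
    finally show ?thesis .
  qed
  then have "coeff_mat n (sform q n a) x $$ (i, j)
      = (\<Sum>k<n. x i ^ (q ^ (2 * k)) * (\<Sum>l<n. (x j ^ q ^ (2 * l)) ^ q * a ((l + n - k) mod n) ^ (q ^ (2 * k))))"
    using ij by (simp add: coeff_mat_def sform_def Tr_def power_mult_distrib)
  also have "\<dots> = (\<Sum>k<n. \<Sum>l<n. x i ^ (q ^ (2 * k)) * (x j ^ (q ^ (2 * l))) ^ q * a ((l + n - k) mod n) ^ (q ^ (2 * k)))"
    by (simp add: sum_distrib_left mult.assoc)
  also have "\<dots> = (\<Sum>l<n. \<Sum>k<n. x i ^ (q ^ (2 * k)) * (x j ^ (q ^ (2 * l))) ^ q * a ((l + n - k) mod n) ^ (q ^ (2 * k)))"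
    by (rule sum.swap)
  also have "\<dots> = (moore x * M_L q n a * star_mat q (moore x)) $$ (i, j)"
    unfolding index_congruence[OF moore_M M_L_M ij] using ij by (simp add: moore_def M_L_def)
  finally show "coeff_mat n (sform q n a) x $$ (i, j)
      = (moore x * M_L q n a * star_mat q (moore x)) $$ (i, j)" .
qed (auto simp: moore_def star_mat_def coeff_mat_def)

text \<open>Raising to the power \<open>q^2\<close> moves each conjugate to the next, so it permutes
  the columns of the Moore matrix cyclically, as \<open>P_mat n\<close> does from the right.\<close>

lemma star_star_moore: "star_mat q (star_mat q (moore x)) = moore x * P_mat n"
proof (rule eq_matI)
  fix i j assume "i < dim_row (moore x * P_mat n)" "j < dim_col (moore x * P_mat n)"
  then have ij: "i < n" "j < n" by (auto simp: moore_def P_mat_def)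
  have "(moore x * P_mat n) $$ (i, j) = (\<Sum>k<n. if k = (j + 1) mod n then x i ^ (q ^ (2 * k)) else 0)"
    using ij by (simp add: moore_def P_mat_def scalar_prod_def lessThan_atLeast0 if_distrib cong: if_cong)
  also have "\<dots> = x i ^ (q ^ (2 * ((j + 1) mod n)))" using n_pos by simp
  also have "\<dots> = x i ^ (q ^ (2 * (j + 1)))" by (rule frob_mod)
  also have "\<dots> = star_mat q (star_mat q (moore x)) $$ (i, j)"
    using ij by (simp add: star_mat_def moore_def power_mult[symmetric] mult_ac)
  finally show "star_mat q (star_mat q (moore x)) $$ (i, j) = (moore x * P_mat n) $$ (i, j)" by simp
qed (auto simp: moore_def P_mat_def star_mat_def)

text \<open>In the product of \<open>star_mat q C\<close> with the inverse of \<open>C\<close>, both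
  taken from the Moore factorization, the inner factors \<open>star_mat q (moore x)\<close> cancel.
  What remains is the conjugate by \<open>moore x\<close> of the matrix built from
  \<open>M_L\<close>, with \<open>P_mat n\<close> coming from
  \<open>star_star_moore\<close>.\<close>

lemma asymmetry_conj_moore:
  fixes a x :: "nat \<Rightarrow> 'a"
  defines "C \<equiv> coeff_mat n (sform q n a) x"
  assumes det: "det C \<noteq> 0"
  shows "P_mat n * star_mat q (M_L q n a) * mat_inv (M_L q n a) \<in> M" (is "?A \<in> M")
    and "conj_GL UNIV n (P_mat n * star_mat q (M_L q n a) * mat_inv (M_L q n a)) (star_mat q C * mat_inv C)"
proof -
  let ?V = "moore x" and ?N = "M_L q n a"
  have C: "C = ?V * ?N * star_mat q ?V" unfolding C_def by (rule coeff_mat_eq_moore)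
  \<comment> \<open>Nonsingularity of \<open>C\<close> passes to every factor, in particular to the
    Moore matrix.\<close>
  have "det C = det ?V * det ?N * det (star_mat q ?V)"
    unfolding C by (simp add: det_mult[of _ n])
  then have dets: "det ?V \<noteq> 0" "det ?N \<noteq> 0" "det (star_mat q ?V) \<noteq> 0" using det by auto
  define W where "W = mat_inv ?V"
  define N' where "N' = mat_inv ?N"
  define U where "U = mat_inv (star_mat q ?V)"
  define D where "D = mat_inv C"
  have W: "W \<in> M" "?V * W = 1\<^sub>m n" "W * ?V = 1\<^sub>m n" unfolding W_def by (rule mat_inv; use dets in simp)+
  have N': "N' \<in> M" "?N * N' = 1\<^sub>m n" "N' * ?N = 1\<^sub>m n" unfolding N'_def by (rule mat_inv; use dets in simp)+
  have U: "U \<in> M" "star_mat q ?V * U = 1\<^sub>m n" "U * star_mat q ?V = 1\<^sub>m n"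
    unfolding U_def by (rule mat_inv; use dets in simp)+
  have CM: "C \<in> M" by (simp add: C_def)
  have D: "D \<in> M" "C * D = 1\<^sub>m n" "D * C = 1\<^sub>m n"
    unfolding D_def by (rule mat_inv[OF CM det])+
  note [simp] = M_assoc M_cancel[OF _ _ _ W(2)] M_cancel[OF _ _ _ W(3)] M_cancel[OF _ _ _ N'(2)]
    M_cancel[OF _ _ _ N'(3)] M_cancel[OF _ _ _ U(2)] M_cancel[OF _ _ _ U(3)]
  have "D = U * (N' * W)"
  proof -
    have "C * (U * (N' * W)) = 1\<^sub>m n" unfolding C using W N' U by simp
    then have "D * (C * (U * (N' * W))) = D" using D by simp
    then show ?thesis using M_cancel[OF D(1) CM _ D(3)] W N' U by simp
  qed
  moreover have "star_mat q C = ?V * (P_mat n * (star_mat q ?N * star_mat q ?V))"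
    unfolding C by (simp add: star_mat_mult[of _ n n _ n] star_star_moore)
  ultimately have "star_mat q C * D = ?V * (P_mat n * star_mat q ?N * N') * W"
    using W N' U by simp
  then show "conj_GL UNIV n ?A (star_mat q C * mat_inv C)"
    using W unfolding conj_GL_def D_def N'_def by blast
  show "?A \<in> M" using N'(1) unfolding N'_def by simp
qed

end

context frobenius_field_basis begin

section \<open>The size of the subfield\<close>

text \<open>Coordinates identify the field with \<open>n\<close>-tuples over the subfield; comparing
  sizes and taking \<open>n\<close>-th roots gives the order.\<close>

lemma card_subF: "card (subF q :: 'a set) = q ^ 2"
proof -
  have "bij_betw (\<lambda>x. \<lambda>i\<in>{..<n}. coord x i) UNIV ({..<n} \<rightarrow>\<^sub>E (subF q :: 'a set))"
    unfolding bij_betw_def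
  proof
    show "inj (\<lambda>x. \<lambda>i\<in>{..<n}. coord x i)"
    proof (rule injI)
      fix x y assume eq: "(\<lambda>i\<in>{..<n}. coord x i) = (\<lambda>i\<in>{..<n}. coord y i)"
      have "coord x i = coord y i" if "i < n" for i
        using fun_cong[OF eq, of i] that by simp
      then have "(\<Sum>i<n. coord x i * \<beta> i) = (\<Sum>i<n. coord y i * \<beta> i)" by simp
      then show "x = y" by (simp only: coord_sum)
    qed
    show "range (\<lambda>x. \<lambda>i\<in>{..<n}. coord x i) = {..<n} \<rightarrow>\<^sub>E (subF q :: 'a set)"
    proof
      show "range (\<lambda>x. \<lambda>i\<in>{..<n}. coord x i) \<subseteq> {..<n} \<rightarrow>\<^sub>E (subF q :: 'a set)"
        by (rule image_subsetI) (simp add: restrict_PiE_iff)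
      show "({..<n} \<rightarrow>\<^sub>E (subF q :: 'a set)) \<subseteq> range (\<lambda>x. \<lambda>i\<in>{..<n}. coord x i)"
      proof
        fix c assume c: "c \<in> {..<n} \<rightarrow>\<^sub>E (subF q :: 'a set)"
        have "c = (\<lambda>i\<in>{..<n}. coord (\<Sum>i<n. c i * \<beta> i) i)"
        proof
          fix i
          have "coord (\<Sum>i<n. c i * \<beta> i) i = c i" if "i < n"
            using c that by (intro coord_eqI) auto
          then show "c i = (\<lambda>i\<in>{..<n}. coord (\<Sum>i<n. c i * \<beta> i) i) i"
            using c by (auto simp: PiE_def extensional_def)
        qed
        then show "c \<in> range (\<lambda>x. \<lambda>i\<in>{..<n}. coord x i)" by blast
      qed
    qed
  qed
  then have "card (UNIV :: 'a set) = card ({..<n} \<rightarrow>\<^sub>E (subF q :: 'a set))" by (rule bij_betw_same_card)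
  then have "card (subF q :: 'a set) ^ n = (q ^ 2) ^ n"
    by (simp add: card_PiE card_field power_mult)
  then show ?thesis using n_pos by (simp add: power_eq_iff_eq_base)
qed

text \<open>The polynomial \<open>x^q - x\<close> has at most \<open>q\<close> roots, fewer than the
  \<open>q^2\<close> elements of the subfield. The element supplies the \<open>\<gamma>\<close> of
  \<open>congruent_if_same_asymmetry\<close>.\<close>

lemma subF_not_fixed:
  obtains \<gamma> :: 'a where "\<gamma> \<in> subF q" "\<gamma> ^ q \<noteq> \<gamma>"
proof -
  let ?p = "monom 1 q - monom 1 1 :: 'a poly"
  have "coeff ?p q = 1" using q_gt_1 by simp
  then have "?p \<noteq> 0" by (metis coeff_0 zero_neq_one)
  then have "card {x. poly ?p x = 0} \<le> degree ?p" by (rule card_poly_roots_bound)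
  also have "\<dots> \<le> q" using q_gt_1 by (intro degree_diff_le) (auto simp: degree_monom_eq)
  also have "q < q ^ 2" using q_gt_1 by (simp add: power2_eq_square)
  also have "\<dots> = card (subF q :: 'a set)" by (simp add: card_subF)
  finally have "\<not> subF q \<subseteq> {x. poly ?p x = 0}" using card_mono[of "{x. poly ?p x = 0}" "subF q"] by auto
  then show ?thesis using that by (auto simp: poly_monom)
qed

end

section \<open>The two equivalences\<close>

locale two_bases = frobenius_field q n ty + b0: frobenius_field_basis q n ty \<beta>0
  + b1: frobenius_field_basis q n ty \<beta>1
  for q n and ty :: "'a::{field,finite} itself" and \<beta>0 \<beta>1 :: "nat \<Rightarrow> 'a" +
  fixes a0 a1 :: "nat \<Rightarrow> 'a" and C0 C1 A0 A1 :: "'a mat"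
  defines C0_def: "C0 \<equiv> coeff_mat n (sform q n a0) \<beta>0"
    and C1_def: "C1 \<equiv> coeff_mat n (sform q n a1) \<beta>1"
    and A0_def: "A0 \<equiv> star_mat q C0 * mat_inv C0"
    and A1_def: "A1 \<equiv> star_mat q C1 * mat_inv C1"
  assumes det0: "det C0 \<noteq> 0" and det1: "det C1 \<noteq> 0"
begin

lemma C_KM: "C0 \<in> KM" "C1 \<in> KM"
  unfolding C0_def C1_def by (rule coeff_mat_KM)+

lemma C_M [simp]: "C0 \<in> M" "C1 \<in> M"
  using C_KM KM_M by auto

lemmas inv0 = mat_inv[OF C_M(1) det0] and inv1 = mat_inv[OF C_M(2) det1]

lemma A_KM: "A0 \<in> KM" "A1 \<in> KM"
  using KM_mult KM_inverse[OF C_KM(1) inv0] KM_inverse[OF C_KM(2) inv1] C_KM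
  by (auto simp: A0_def A1_def KM_iff)

lemma A_M [simp]: "A0 \<in> M" "A1 \<in> M"
  using A_KM KM_M by auto

lemma star_C: "star_mat q C0 = A0 * C0" "star_mat q C1 = A1 * C1"
  using inv0 inv1 by (simp_all add: A0_def A1_def M_assoc)

text \<open>\<open>C0\<close> is also the coefficient matrix of the second form on the images under
  \<open>\<tau>\<close> of the first basis; \<open>S\<close> holds the coordinates of these images
  in the second basis.\<close>

lemma forms_equiv_imp_congruent:
  assumes "forms_equiv q (sform q n a0) (sform q n a1)"
  obtains S where "S \<in> KM" "C0 = S * C1 * star_mat q S"
proof -
  obtain \<tau> where \<tau>: "\<And>u v. sform q n a0 u v = sform q n a1 (\<tau> u) (\<tau> v)"
    using assms unfolding forms_equiv_def by blast
  define S where "S = mat n n (\<lambda>(i, j). b1.coord (\<tau> (\<beta>0 i)) j)"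
  have S: "S \<in> KM" by (auto simp: S_def KM_def)
  have "C0 = coeff_mat n (sform q n a1) (\<lambda>i. \<tau> (\<beta>0 i))"
    unfolding C0_def coeff_mat_def by (simp add: \<tau>)
  also have "\<dots> = S * C1 * star_mat q S"
    unfolding C1_def by (rule coeff_mat_change[OF S]) (simp add: S_def b1.coord_sum)
  finally show ?thesis using S that by blast
qed

text \<open>The map \<open>\<tau>\<close> sends \<open>\<beta>0 i\<close> to the vector whose
  coordinates in the second basis are row \<open>i\<close> of \<open>R\<close>. The forms then agree
  on basis vectors, hence everywhere.\<close>

lemma congruent_imp_forms_equiv:
  assumes R: "R \<in> KM" "T \<in> KM" "T * R = 1\<^sub>m n" and C: "C0 = R * C1 * star_mat q R"
  shows "forms_equiv q (sform q n a0) (sform q n a1)"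
proof -
  define y where "y i = (\<Sum>k<n. R $$ (i, k) * \<beta>1 k)" for i
  define \<tau> where "\<tau> u = (\<Sum>i<n. b0.coord u i * y i)" for u
  have RM: "R \<in> M" "T \<in> M" using R KM_M by auto
  have C0: "C0 = coeff_mat n (sform q n a1) y"
    unfolding C C1_def by (rule coeff_mat_change[OF R(1), symmetric]) (simp add: y_def)
  then have C0y: "sform q n a1 (y i) (y j) = sform q n a0 (\<beta>0 i) (\<beta>0 j)" if "i < n" "j < n" for i j
  proof -
    have "coeff_mat n (sform q n a1) y $$ (i, j) = C0 $$ (i, j)" by (simp only: C0)
    then show ?thesis using that by (simp add: C0_def coeff_mat_def)
  qed
  have lin: "\<tau> (\<Sum>l\<in>L. k l * x l) = (\<Sum>l\<in>L. k l * \<tau> (x l))"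
    if "\<And>l. l \<in> L \<Longrightarrow> k l \<in> subF q" for L :: "nat set" and k x
  proof -
    have "\<tau> (\<Sum>l\<in>L. k l * x l) = (\<Sum>i<n. \<Sum>l\<in>L. k l * b0.coord (x l) i * y i)"
      unfolding \<tau>_def by (intro sum.cong refl) (simp add: b0.coord_linear that sum_distrib_right)
    also have "\<dots> = (\<Sum>l\<in>L. \<Sum>i<n. k l * b0.coord (x l) i * y i)" by (rule sum.swap)
    finally show ?thesis by (simp add: \<tau>_def sum_distrib_left mult.assoc)
  qed
  have "\<tau> (u + v) = \<tau> u + \<tau> v" for u v
    using lin[of "{0, 1}" "\<lambda>_. 1" "\<lambda>l. if l = 0 then u else v"] by simp
  moreover have "\<tau> (c * u) = c * \<tau> u" if "c \<in> subF q" for c u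
    using lin[of "{0}" "\<lambda>_. c" "\<lambda>_. u"] that by simp
  moreover have "surj \<tau>"
  \<comment> \<open>The rows of \<open>T\<close> yield preimages of the vectors
    \<open>\<beta>1 k\<close>, hence of every \<open>z\<close>. Injectivity follows from
    finiteness.\<close>
  proof (rule surjI)
    fix z
    have \<tau>\<beta>: "\<tau> (\<beta>0 i) = y i" if "i < n" for i
    proof -
      have "b0.coord (\<beta>0 i) k = (if k = i then 1 else 0)" if "k < n" for k
        using that \<open>i < n\<close> by (intro b0.coord_eqI) (auto simp: if_distrib[of "\<lambda>c. c * _"] cong: if_cong)
      then have "\<tau> (\<beta>0 i) = (\<Sum>k<n. (if k = i then 1 else 0) * y k)" by (simp add: \<tau>_def)
      then show ?thesis using that by (simp add: if_distrib[of "\<lambda>c. c * _"] cong: if_cong)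
    qed
    have T\<beta>: "\<tau> (\<Sum>i<n. T $$ (k, i) * \<beta>0 i) = \<beta>1 k" if k: "k < n" for k
    proof -
      have "\<tau> (\<Sum>i<n. T $$ (k, i) * \<beta>0 i) = (\<Sum>i<n. T $$ (k, i) * y i)"
        using R(2) k \<tau>\<beta> by (subst lin) (auto simp: KM_def)
      also have "\<dots> = (\<Sum>i<n. \<Sum>j<n. T $$ (k, i) * R $$ (i, j) * \<beta>1 j)"
        by (simp add: y_def sum_distrib_left mult.assoc)
      also have "\<dots> = (\<Sum>j<n. (\<Sum>i<n. T $$ (k, i) * R $$ (i, j)) * \<beta>1 j)"
        by (subst sum.swap) (simp add: sum_distrib_right)
      also have "\<dots> = (\<Sum>j<n. (T * R) $$ (k, j) * \<beta>1 j)"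
        using RM k by (simp add: scalar_prod_def lessThan_atLeast0)
      also have "\<dots> = (\<Sum>j<n. (if k = j then 1 else 0) * \<beta>1 j)"
        using k by (intro sum.cong refl) (simp add: R(3))
      finally show ?thesis using k by (simp add: if_distrib[of "\<lambda>c. c * _"] cong: if_cong)
    qed
    show "\<tau> (\<Sum>k<n. b1.coord z k * (\<Sum>i<n. T $$ (k, i) * \<beta>0 i)) = z"
      by (subst lin) (simp_all add: T\<beta> b1.coord_sum)
  qed
  then have "bij \<tau>" using finite_UNIV_surj_inj[of \<tau>] by (simp add: bij_def)
  ultimately have "lin_aut q \<tau>" by (auto simp: lin_aut_def)
  moreover have "sform q n a0 u v = sform q n a1 (\<tau> u) (\<tau> v)" for u v
  proof -
    have "sform q n a0 u v = sform q n a0 (\<Sum>i<n. b0.coord u i * \<beta>0 i) (\<Sum>j<n. b0.coord v j * \<beta>0 j)"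
      by (simp only: b0.coord_sum)
    also have "\<dots> = (\<Sum>i<n. b0.coord u i * (\<Sum>j<n. b0.coord v j ^ q * sform q n a0 (\<beta>0 i) (\<beta>0 j)))"
      by (rule sform_sum_sum) auto
    also have "\<dots> = (\<Sum>i<n. b0.coord u i * (\<Sum>j<n. b0.coord v j ^ q * sform q n a1 (y i) (y j)))"
      by (simp add: C0y)
    also have "\<dots> = sform q n a1 (\<tau> u) (\<tau> v)"
      unfolding \<tau>_def by (rule sform_sum_sum[symmetric]) auto
    finally show ?thesis .
  qed
  ultimately show ?thesis unfolding forms_equiv_def by blast
qed

lemma conj_GL_subF_iff:
  "conj_GL (subF q) n A B \<longleftrightarrow> (\<exists>S\<in>KM. \<exists>T\<in>KM. S * T = 1\<^sub>m n \<and> T * S = 1\<^sub>m n \<and> B = S * A * T)"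
proof
  assume "conj_GL (subF q) n A B"
  then obtain S T where S: "S \<in> M" "T \<in> M" "S * T = 1\<^sub>m n" "T * S = 1\<^sub>m n" "B = S * A * T"
    and K: "\<forall>i<n. \<forall>j<n. S $$ (i, j) \<in> subF q \<and> T $$ (i, j) \<in> subF q"
    unfolding conj_GL_def by blast
  have "S \<in> KM" "T \<in> KM" using S(1,2) K unfolding KM_def by blast+
  then show "\<exists>S\<in>KM. \<exists>T\<in>KM. S * T = 1\<^sub>m n \<and> T * S = 1\<^sub>m n \<and> B = S * A * T"
    using S by blast
next
  assume "\<exists>S\<in>KM. \<exists>T\<in>KM. S * T = 1\<^sub>m n \<and> T * S = 1\<^sub>m n \<and> B = S * A * T"
  then obtain S T where S: "S \<in> KM" "T \<in> KM" "S * T = 1\<^sub>m n" "T * S = 1\<^sub>m n" "B = S * A * T"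
    by blast
  have "S \<in> M" "T \<in> M" "\<forall>i<n. \<forall>j<n. S $$ (i, j) \<in> subF q \<and> T $$ (i, j) \<in> subF q"
    using S(1,2) unfolding KM_def by blast+
  then show "conj_GL (subF q) n A B" unfolding conj_GL_def using S(3-5) by blast
qed

text \<open>A congruence by \<open>S\<close> conjugates the asymmetries by \<open>S\<close>.
  Conversely, conjugate asymmetries are first made equal by a change of basis, which reduces to
  \<open>congruent_if_same_asymmetry\<close>.\<close>

theorem forms_equiv_iff_asymmetries_conj:
  "forms_equiv q (sform q n a0) (sform q n a1) \<longleftrightarrow> conj_GL (subF q) n A0 A1"
proof
  assume "forms_equiv q (sform q n a0) (sform q n a1)"
  then obtain S where S: "S \<in> KM" "C0 = S * C1 * star_mat q S"
    using forms_equiv_imp_congruent by blast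
  have SM: "S \<in> M" "star_mat q (star_mat q S) = S" using S by (simp_all add: KM_iff)
  have "det C0 = det S * det C1 * det (star_mat q S)"
    unfolding S(2) using SM by (simp add: det_mult[of _ n])
  \<comment> \<open>Invertibility of \<open>S\<close> is obtained from determinants rather than from
    bijectivity of the map.\<close>
  then have "det S \<noteq> 0" using det0 by auto
  note T = mat_inv[OF SM(1) this]
  define T where "T = mat_inv S"
  have T: "T \<in> M" "S * T = 1\<^sub>m n" "T * S = 1\<^sub>m n" unfolding T_def by (rule T)+
  have TK: "T \<in> KM" using KM_inverse[OF S(1) T] .
  note [simp] = M_assoc M_cancel[OF _ _ _ T(2)] M_cancel[OF _ _ _ T(3)]
  have "star_mat q C0 = S * (A1 * (C1 * star_mat q S))"
    unfolding S(2) using SM by (simp add: star_mat_mult[of _ n n _ n] star_C)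
  also have "\<dots> = S * (A1 * (T * C0))" unfolding S(2) using SM T by simp
  finally have "A0 * C0 = S * (A1 * (T * C0))" by (simp add: star_C)
  then have "A0 * C0 * mat_inv C0 = S * (A1 * (T * C0)) * mat_inv C0" by simp
  then have "A0 = S * (A1 * T)" using inv0 SM T by simp
  then have "A1 = T * A0 * S" using SM T by simp
  then show "conj_GL (subF q) n A0 A1" unfolding conj_GL_subF_iff using T TK S by blast
next
  assume "conj_GL (subF q) n A0 A1"
  then obtain S T where S: "S \<in> KM" "T \<in> KM" "S * T = 1\<^sub>m n" "T * S = 1\<^sub>m n" "A1 = S * A0 * T"
    unfolding conj_GL_subF_iff by blast
  have SM: "S \<in> M" "T \<in> M" "star_mat q (star_mat q S) = S" "star_mat q (star_mat q T) = T"
    using S by (simp_all add: KM_iff)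
  note [simp] = M_assoc M_cancel[OF _ _ _ S(3)] M_cancel[OF _ _ _ S(4)] SM
    M_cancel[OF _ _ _ inv0(2)] M_cancel[OF _ _ _ inv0(3)] M_cancel[OF _ _ _ inv1(2)] M_cancel[OF _ _ _ inv1(3)]
  have st: "star_mat q S * star_mat q T = 1\<^sub>m n" "star_mat q T * star_mat q S = 1\<^sub>m n"
    using S(3,4) SM by (metis star_mat_mult star_mat_one)+
  note [simp] = M_cancel[OF _ _ _ st(1)] M_cancel[OF _ _ _ st(2)]
  \<comment> \<open>The second form after the change of basis by \<open>T\<close>, the inverse of
    \<open>S\<close>. Its asymmetry is \<open>A0\<close>, and \<open>D\<close> is its
    inverse.\<close>
  define C where "C = T * (C1 * star_mat q T)"
  define D where "D = star_mat q S * (mat_inv C1 * S)"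
  have CM: "C \<in> M" "D \<in> M" using inv1 by (simp_all add: C_def D_def)
  have KC: "star_mat q (star_mat q C) = C" "star_mat q (star_mat q C0) = C0"
    using C_KM by (simp_all add: C_def KM_iff star_mat_mult[of _ n n _ n])
  have CD: "C * D = 1\<^sub>m n" "D * C = 1\<^sub>m n" using inv1 S st by (simp_all add: C_def D_def)
  have "star_mat q C = T * (A1 * (C1 * star_mat q T))"
    by (simp add: C_def star_mat_mult[of _ n n _ n] star_C)
  also have "\<dots> = A0 * C" by (simp add: S(5) C_def)
  finally have CA: "star_mat q C = A0 * C" .
  obtain \<gamma> :: 'a where \<gamma>: "\<gamma> \<in> subF q" "\<gamma> ^ q \<noteq> \<gamma>" using b0.subF_not_fixed by blast
  obtain X Y where X: "X \<in> M" "Y \<in> M" "X * Y = 1\<^sub>m n" "Y * X = 1\<^sub>m n"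
    "star_mat q (star_mat q X) = X" "C = X * C0 * star_mat q X"
    using congruent_if_same_asymmetry[OF \<gamma> C_M(1) CM(1) inv0(1) CM(2) A_M(1) KC(2,1) inv0(2,3) CD star_C(1) CA]
    by blast
  have XK: "X \<in> KM" using X by (simp add: KM_iff)
  have YK: "Y \<in> KM" using KM_inverse[OF XK X(2-4)] .
  have sY: "star_mat q X * star_mat q Y = 1\<^sub>m n" using X by (metis star_mat_mult star_mat_one)
  \<comment> \<open>Both congruences are undone: from \<open>C0\<close> to \<open>C\<close> by
    \<open>X\<close>, and from \<open>C1\<close> to \<open>C\<close> by \<open>T\<close>.\<close>
  have "C0 = Y * (C * star_mat q Y)" unfolding X(6) using X sY
    by (simp add: M_cancel[OF _ _ _ X(4)])
  also have "\<dots> = (Y * T) * C1 * star_mat q (Y * T)"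
    using X(1-5) by (simp add: C_def star_mat_mult[of _ n n _ n])
  finally have "C0 = (Y * T) * C1 * star_mat q (Y * T)" .
  moreover have "(S * X) * (Y * T) = 1\<^sub>m n" using X S by (simp add: M_cancel[OF _ _ _ X(3)])
  ultimately show "forms_equiv q (sform q n a0) (sform q n a1)"
    using congruent_imp_forms_equiv[of "Y * T" "S * X"] KM_mult YK XK S by blast
qed

text \<open>Over the large field each asymmetry is conjugate to its matrix built from
  \<open>M_L\<close>, by \<open>asymmetry_conj_moore\<close>. Only the return to the subfield needs
  \<open>conj_descent\<close>.\<close>

theorem asymmetries_conj_iff:
  "conj_GL (subF q) n A0 A1 \<longleftrightarrow> conj_GL UNIV n
     (P_mat n * star_mat q (M_L q n a0) * mat_inv (M_L q n a0))
     (P_mat n * star_mat q (M_L q n a1) * mat_inv (M_L q n a1))"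
    (is "_ \<longleftrightarrow> conj_GL UNIV n ?N0 ?N1")
proof -
  have c0: "conj_GL UNIV n ?N0 A0" and c1: "conj_GL UNIV n ?N1 A1"
    and N: "?N0 \<in> M" "?N1 \<in> M"
    using asymmetry_conj_moore[of a0 \<beta>0] asymmetry_conj_moore[of a1 \<beta>1] det0 det1
    unfolding A0_def A1_def C0_def C1_def by blast+
  show ?thesis
  proof
    assume "conj_GL (subF q) n A0 A1"
    then have "conj_GL UNIV n A0 A1" unfolding conj_GL_def by blast
    then show "conj_GL UNIV n ?N0 ?N1"
      using c0 c1 N conj_GL_UNIV_sym conj_GL_UNIV_trans A_M by metis
  next
    assume "conj_GL UNIV n ?N0 ?N1"
    then have "conj_GL UNIV n A0 A1"
      using c0 c1 N conj_GL_UNIV_sym conj_GL_UNIV_trans A_M by metis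
    then obtain S T where "S \<in> M" "T \<in> M" "S * T = 1\<^sub>m n" "T * S = 1\<^sub>m n" "A1 = S * A0 * T"
      unfolding conj_GL_def by blast
    then show "conj_GL (subF q) n A0 A1"
      unfolding conj_GL_subF_iff using b0.conj_descent[OF A_KM] by metis
  qed
qed

end

theorem theorem2p4:
  fixes q n :: nat
    and a0 a1 :: "nat \<Rightarrow> 'a::{field,finite}"
    and \<beta>0 \<beta>1 :: "nat \<Rightarrow> 'a"
  assumes "prime_power q"
    and "n > 0"
    and "card (UNIV :: 'a set) = q ^ (2*n)"
    and "is_basis q n \<beta>0" and "is_basis q n \<beta>1"
    and "det (coeff_mat n (sform q n a0) \<beta>0) \<noteq> 0"
    and "det (coeff_mat n (sform q n a1) \<beta>1) \<noteq> 0"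
  shows "(forms_equiv q (sform q n a0) (sform q n a1)
           \<longleftrightarrow> conj_GL (subF q) n
                 (star_mat q (coeff_mat n (sform q n a0) \<beta>0) * mat_inv (coeff_mat n (sform q n a0) \<beta>0))
                 (star_mat q (coeff_mat n (sform q n a1) \<beta>1) * mat_inv (coeff_mat n (sform q n a1) \<beta>1)))
       \<and> (conj_GL (subF q) n
                 (star_mat q (coeff_mat n (sform q n a0) \<beta>0) * mat_inv (coeff_mat n (sform q n a0) \<beta>0))
                 (star_mat q (coeff_mat n (sform q n a1) \<beta>1) * mat_inv (coeff_mat n (sform q n a1) \<beta>1))
           \<longleftrightarrow> conj_GL UNIV n
                 (P_mat n * star_mat q (M_L q n a0) * mat_inv (M_L q n a0))
                 (P_mat n * star_mat q (M_L q n a1) * mat_inv (M_L q n a1)))"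
proof -
  obtain p k where p: "prime p" "k > 0" "q = p ^ k" using assms(1) unfolding prime_power_def by blast
  have CHAR: "prime CHAR('a)" using prime_CHAR_semidom[where 'a = 'a] finite_imp_CHAR_pos[where 'a = 'a] by simp
  \<comment> \<open>The characteristic divides the order of the field, a power of \<open>p\<close>,
    so it is \<open>p\<close>; this makes the \<open>q\<close>-th power additive.\<close>
  have "CHAR('a) dvd p ^ (k * (2 * n))"
    using CHAR_dvd_card_field[where 'a = 'a] by (simp add: assms(3) p(3) power_mult)
  then have "CHAR('a) = p" using CHAR p(1) by (metis prime_dvd_power primes_dvd_imp_eq)
  then have add: "(x + y) ^ q = x ^ q + y ^ q" for x y :: 'a
    using p(3) by (intro freshmans_dream'[OF CHAR]) simp
  have q1: "q > 1" unfolding p(3) using p(2) prime_gt_1_nat[OF p(1)] by (intro one_less_power)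
  interpret two_bases q n "TYPE('a)" \<beta>0 \<beta>1 a0 a1
    "coeff_mat n (sform q n a0) \<beta>0" "coeff_mat n (sform q n a1) \<beta>1"
    "star_mat q (coeff_mat n (sform q n a0) \<beta>0) * mat_inv (coeff_mat n (sform q n a0) \<beta>0)"
    "star_mat q (coeff_mat n (sform q n a1) \<beta>1) * mat_inv (coeff_mat n (sform q n a1) \<beta>1)"
    by unfold_locales (use assms add q1 in simp_all)
  show ?thesis using forms_equiv_iff_asymmetries_conj asymmetries_conj_iff by blast
qed

end
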